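(* Let $\lambda \in \mathbb{C}^\times$ and $b \in \mathbb{C}$. Then $\Omega (\lambda, b) \cong V_\mu^{t - \lambda}$ as $\mathrm{Vir}$-modules, where $\mu:\mathrm{Vir}^{t-\lambda}\to\mathbb{C}$ is the Lie algebra homomorphism defined by $\mu(e_{k+1} - \lambda e_k)=\lambda^{k+1} (b-1)$ for $k\in\mathbb{Z}$ and $\mu(z)=0$.
   Context: The Virasoro algebra $\mathrm{Vir}$ is the complex Lie algebra with basis $\{z\}\cup\{e_j \mid j\in\mathbb{Z}\}$ and bracket $[e_j,e_k]=(k-j)e_{j+k}+\delta_{k,-j}\frac{j^3-j}{12}z$, $[z,e_j]=0$. For $\lambda\in\mathbb{C}^\times$, $\mathrm{Vir}^{t-\lambda}=\mathrm{span}_{\mathbb{C}}\{z,\ e_{k+1}-\lambda e_k\mid k\in\mathbb{Z}\}$, a Lie subalgebra of $\mathrm{Vir}$. For a Lie algebra homomorphism $\mu:\mathrm{Vir}^{t-\lambda}\to\mathbb{C}$ ($\mathbb{C}$ abelian), $\mathbb{C}_\mu$ is the one-dimensional $\mathrm{Vir}^{t-\lambda}$-module on which $x$ acts by $\mu(x)$, and $V_\mu^{t-\lambda}=U(\mathrm{Vir})\otimes_{U(\mathrm{Vir}^{t-\lambda})}\mathbb{C}_\mu$ is the induced $\mathrm{Vir}$-module. For $\lambda\in\mathbb{C}^\times$, $b\in\mathbb{C}$, $\Omega(\lambda,b)$ is the $\mathrm{Vir}$-module with basis $\{\partial^n\mid n\in\mathbb{Z}_{\ge0}\}$ (i.e.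 underlying space the polynomial ring $\mathbb{C}[\partial]$) and action $e_k\,\partial^n=\lambda^k(\partial+k(b-1))(\partial-k)^n$ for $k\in\mathbb{Z}$, and $z\,\partial^n=0$. *)

theory Defs
  imports
    "HOL-Algebra.QuotRing"
    "HOL-Algebra.Module"
    "HOL-Algebra.Free_Abelian_Groups"
    "HOL-Library.Poly_Mapping"
    "HOL-Computational_Algebra.Polynomial"
    Complex_Main
begin

section \<open>Complex Lie algebras and their modules\<close>

definition complex_ring :: "complex ring" where
  "complex_ring = \<lparr>carrier = UNIV, monoid.mult = (*), one = 1, ring.zero = 0, ring.add = (+)\<rparr>"

text \<open>The record \<^type>\<open>module\<close> inherits the fields \<open>mult\<close> and \<open>one\<close> of a ring. The locale
  \<^locale>\<open>module\<close> does not refer to them, and they are \<open>undefined\<close> in all instances below.\<close>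

record 'g lie = "(complex, 'g) module" +
  bracket :: "'g \<Rightarrow> 'g \<Rightarrow> 'g"

locale lie_algebra = Module.module complex_ring L for L :: "('g, 'x) lie_scheme" (structure) +
  assumes bracket_closed: "\<lbrakk>x \<in> carrier L; y \<in> carrier L\<rbrakk> \<Longrightarrow> bracket L x y \<in> carrier L"
    and bracket_add_left: "\<lbrakk>x \<in> carrier L; y \<in> carrier L; w \<in> carrier L\<rbrakk> \<Longrightarrow>
      bracket L (x \<oplus> y) w = bracket L x w \<oplus> bracket L y w"
    and bracket_add_right: "\<lbrakk>x \<in> carrier L; y \<in> carrier L; w \<in> carrier L\<rbrakk> \<Longrightarrow>
      bracket L x (y \<oplus> w) = bracket L x y \<oplus> bracket L x w"
    and bracket_smult_left: "\<lbrakk>x \<in> carrier L; y \<in> carrier L\<rbrakk> \<Longrightarrow>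
      bracket L (c \<odot>\<^bsub>L\<^esub> x) y = c \<odot>\<^bsub>L\<^esub> bracket L x y"
    and bracket_smult_right: "\<lbrakk>x \<in> carrier L; y \<in> carrier L\<rbrakk> \<Longrightarrow>
      bracket L x (c \<odot>\<^bsub>L\<^esub> y) = c \<odot>\<^bsub>L\<^esub> bracket L x y"
    and bracket_self: "x \<in> carrier L \<Longrightarrow> bracket L x x = \<zero>"
    and jacobi: "\<lbrakk>x \<in> carrier L; y \<in> carrier L; w \<in> carrier L\<rbrakk> \<Longrightarrow>
      bracket L x (bracket L y w) \<oplus> bracket L y (bracket L w x) \<oplus> bracket L w (bracket L x y) = \<zero>"

locale lie_hom = dom: lie_algebra L + cod: lie_algebra M
  for L :: "('g, 'x) lie_scheme" and M :: "('h, 'y) lie_scheme" and f :: "'g \<Rightarrow> 'h" +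
  assumes hom_closed: "x \<in> carrier L \<Longrightarrow> f x \<in> carrier M"
    and hom_add: "\<lbrakk>x \<in> carrier L; y \<in> carrier L\<rbrakk> \<Longrightarrow> f (x \<oplus>\<^bsub>L\<^esub> y) = f x \<oplus>\<^bsub>M\<^esub> f y"
    and hom_smult: "x \<in> carrier L \<Longrightarrow> f (c \<odot>\<^bsub>L\<^esub> x) = c \<odot>\<^bsub>M\<^esub> f x"
    and hom_bracket: "\<lbrakk>x \<in> carrier L; y \<in> carrier L\<rbrakk> \<Longrightarrow>
      f (bracket L x y) = bracket M (f x) (f y)"

record ('g, 'v) lie_mod = "(complex, 'v) module" +
  act :: "'g \<Rightarrow> 'v \<Rightarrow> 'v"

locale lie_module = L: lie_algebra L + V: Module.module complex_ring V
  for L :: "('g, 'x) lie_scheme" and V :: "('g, 'v, 'y) lie_mod_scheme" +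
  assumes act_closed: "\<lbrakk>x \<in> carrier L; v \<in> carrier V\<rbrakk> \<Longrightarrow> act V x v \<in> carrier V"
    and act_add_left: "\<lbrakk>x \<in> carrier L; y \<in> carrier L; v \<in> carrier V\<rbrakk> \<Longrightarrow>
      act V (x \<oplus>\<^bsub>L\<^esub> y) v = act V x v \<oplus>\<^bsub>V\<^esub> act V y v"
    and act_smult_left: "\<lbrakk>x \<in> carrier L; v \<in> carrier V\<rbrakk> \<Longrightarrow>
      act V (c \<odot>\<^bsub>L\<^esub> x) v = c \<odot>\<^bsub>V\<^esub> act V x v"
    and act_add_right: "\<lbrakk>x \<in> carrier L; v \<in> carrier V; w \<in> carrier V\<rbrakk> \<Longrightarrow>
      act V x (v \<oplus>\<^bsub>V\<^esub> w) = act V x v \<oplus>\<^bsub>V\<^esub> act V x w"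
    and act_smult_right: "\<lbrakk>x \<in> carrier L; v \<in> carrier V\<rbrakk> \<Longrightarrow>
      act V x (c \<odot>\<^bsub>V\<^esub> v) = c \<odot>\<^bsub>V\<^esub> act V x v"
    and act_bracket: "\<lbrakk>x \<in> carrier L; y \<in> carrier L; v \<in> carrier V\<rbrakk> \<Longrightarrow>
      act V (bracket L x y) v = act V x (act V y v) \<ominus>\<^bsub>V\<^esub> act V y (act V x v)"

locale lie_module_iso = V: lie_module L V + W: lie_module L W
  for L :: "('g, 'x) lie_scheme" and V :: "('g, 'v, 'y) lie_mod_scheme"
    and W :: "('g, 'w, 'z) lie_mod_scheme" and f :: "'v \<Rightarrow> 'w" +
  assumes iso_bij: "bij_betw f (carrier V) (carrier W)"
    and iso_add: "\<lbrakk>v \<in> carrier V; w \<in> carrier V\<rbrakk> \<Longrightarrow> f (v \<oplus>\<^bsub>V\<^esub> w) = f v \<oplus>\<^bsub>W\<^esub> f w"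
    and iso_smult: "v \<in> carrier V \<Longrightarrow> f (c \<odot>\<^bsub>V\<^esub> v) = c \<odot>\<^bsub>W\<^esub> f v"
    and iso_act: "\<lbrakk>x \<in> carrier L; v \<in> carrier V\<rbrakk> \<Longrightarrow> f (act V x v) = act W x (f v)"

definition lie_module_isomorphic ::
    "('g, 'x) lie_scheme \<Rightarrow> ('g, 'v, 'y) lie_mod_scheme \<Rightarrow> ('g, 'w, 'z) lie_mod_scheme \<Rightarrow> bool" where
  "lie_module_isomorphic L V W \<longleftrightarrow> (\<exists>f. lie_module_iso L V W f)"

definition abelian_complex :: "complex lie" where
  "abelian_complex = \<lparr>carrier = UNIV, monoid.mult = undefined, one = undefined, ring.zero = 0,
     ring.add = (+), module.smult = (*), bracket = (\<lambda>_ _. 0)\<rparr>"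

text \<open>The one-dimensional module on which \<open>x\<close> acts by the scalar \<open>\<mu> x\<close>.\<close>

definition char_module :: "('g \<Rightarrow> complex) \<Rightarrow> ('g, complex) lie_mod" where
  "char_module \<mu> = \<lparr>carrier = UNIV, monoid.mult = undefined, one = undefined, ring.zero = 0,
     ring.add = (+), module.smult = (*), act = (\<lambda>x c. \<mu> x * c)\<rparr>"

section \<open>The universal enveloping algebra\<close>

text \<open>Words form the free monoid, so that \<open>'g word \<Rightarrow>\<^sub>0 complex\<close>, with the convolution product of
  \<^theory>\<open>HOL-Library.Poly_Mapping\<close>, is the free unital associative algebra on the set \<open>'g\<close>.\<close>

datatype 'g word = Word (letters: "'g list")

instantiation word :: (type) monoid_add
begin

definition zero_word :: "'g word" where "zero_word = Word []"

definition plus_word :: "'g word \<Rightarrow> 'g word \<Rightarrow> 'g word" where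
  "plus_word u v = Word (letters u @ letters v)"

instance
  by standard (simp_all add: zero_word_def plus_word_def)

end

type_synonym 'g free_alg = "'g word \<Rightarrow>\<^sub>0 complex"

abbreviation free_gen :: "'g \<Rightarrow> 'g free_alg" where
  "free_gen x \<equiv> Poly_Mapping.single (Word [x]) 1"

abbreviation free_const :: "complex \<Rightarrow> 'g free_alg" where
  "free_const c \<equiv> Poly_Mapping.single 0 c"

definition free_algebra :: "'g set \<Rightarrow> 'g free_alg ring" where
  "free_algebra X = \<lparr>carrier = {p. \<forall>w \<in> Poly_Mapping.keys p. set (letters w) \<subseteq> X},
     monoid.mult = (*), one = 1, ring.zero = 0, ring.add = (+)\<rparr>"

text \<open>The first two families of relations make the generators depend linearly on the elements of
  \<open>L\<close>; they cut the free algebra on the set \<open>carrier L\<close> down to the tensor algebra of the vector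
  space \<open>L\<close>.\<close>

definition env_relations :: "('g, 'x) lie_scheme \<Rightarrow> 'g free_alg set" where
  "env_relations L =
     {free_gen (x \<oplus>\<^bsub>L\<^esub> y) - (free_gen x + free_gen y) | x y. x \<in> carrier L \<and> y \<in> carrier L}
   \<union> {free_gen (c \<odot>\<^bsub>L\<^esub> x) - free_const c * free_gen x | c x. x \<in> carrier L}
   \<union> {free_gen x * free_gen y - free_gen y * free_gen x - free_gen (bracket L x y) | x y.
        x \<in> carrier L \<and> y \<in> carrier L}"

definition env_ideal :: "('g, 'x) lie_scheme \<Rightarrow> 'g free_alg set" where
  "env_ideal L = Idl\<^bsub>free_algebra (carrier L)\<^esub> (env_relations L)"

definition env :: "('g, 'x) lie_scheme \<Rightarrow> 'g free_alg set ring" where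
  "env L = free_algebra (carrier L) Quot env_ideal L"

definition env_class :: "('g, 'x) lie_scheme \<Rightarrow> 'g free_alg \<Rightarrow> 'g free_alg set" where
  "env_class L p = env_ideal L +>\<^bsub>free_algebra (carrier L)\<^esub> p"

text \<open>The map \<open>U(K) \<rightarrow> U(L)\<close> induced by the inclusion of a subalgebra \<open>K\<close> into \<open>L\<close>. As in the
  library's treatment of quotient groups, a map on cosets is defined as \<^const>\<open>the_elem\<close> of the
  image of the coset, which is a singleton.\<close>

definition env_incl :: "('g, 'x) lie_scheme \<Rightarrow> 'g free_alg set \<Rightarrow> 'g free_alg set" where
  "env_incl L X = the_elem (env_class L ` X)"

definition free_act :: "('g, 'v, 'y) lie_mod_scheme \<Rightarrow> 'g free_alg \<Rightarrow> 'v \<Rightarrow> 'v" where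
  "free_act V p v =
     (\<Oplus>\<^bsub>V\<^esub> w \<in> Poly_Mapping.keys p. Poly_Mapping.lookup p w \<odot>\<^bsub>V\<^esub> foldr (act V) (letters w) v)"

definition env_act :: "('g, 'v, 'y) lie_mod_scheme \<Rightarrow> 'g free_alg set \<Rightarrow> 'v \<Rightarrow> 'v" where
  "env_act V X v = the_elem ((\<lambda>p. free_act V p v) ` X)"

section \<open>Tensor products over a noncommutative ring\<close>

text \<open>The tensor product over \<open>R\<close> of a right module \<open>M\<close> and a left module \<open>N\<close>, with actions
  \<open>ra\<close> and \<open>la\<close>: the quotient of the free abelian group on \<open>M \<times> N\<close> by the biadditivity and
  balancing relations.\<close>

definition tensor_relations ::
    "('r, 'a) ring_scheme \<Rightarrow> ('m, 'b) ring_scheme \<Rightarrow> ('m \<Rightarrow> 'r \<Rightarrow> 'm) \<Rightarrow>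
     ('n, 'c) ring_scheme \<Rightarrow> ('r \<Rightarrow> 'n \<Rightarrow> 'n) \<Rightarrow> ('m \<times> 'n \<Rightarrow>\<^sub>0 int) set" where
  "tensor_relations R M ra N la =
     {frag_of (m \<oplus>\<^bsub>M\<^esub> m', n) - (frag_of (m, n) + frag_of (m', n)) | m m' n.
        m \<in> carrier M \<and> m' \<in> carrier M \<and> n \<in> carrier N}
   \<union> {frag_of (m, n \<oplus>\<^bsub>N\<^esub> n') - (frag_of (m, n) + frag_of (m, n')) | m n n'.
        m \<in> carrier M \<and> n \<in> carrier N \<and> n' \<in> carrier N}
   \<union> {frag_of (ra m r, n) - frag_of (m, la r n) | m r n.
        m \<in> carrier M \<and> r \<in> carrier R \<and> n \<in> carrier N}"

definition tensor_kernel ::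
    "('r, 'a) ring_scheme \<Rightarrow> ('m, 'b) ring_scheme \<Rightarrow> ('m \<Rightarrow> 'r \<Rightarrow> 'm) \<Rightarrow>
     ('n, 'c) ring_scheme \<Rightarrow> ('r \<Rightarrow> 'n \<Rightarrow> 'n) \<Rightarrow> ('m \<times> 'n \<Rightarrow>\<^sub>0 int) set" where
  "tensor_kernel R M ra N la =
     generate (free_Abelian_group (carrier M \<times> carrier N)) (tensor_relations R M ra N la)"

definition tensor_product ::
    "('r, 'a) ring_scheme \<Rightarrow> ('m, 'b) ring_scheme \<Rightarrow> ('m \<Rightarrow> 'r \<Rightarrow> 'm) \<Rightarrow>
     ('n, 'c) ring_scheme \<Rightarrow> ('r \<Rightarrow> 'n \<Rightarrow> 'n) \<Rightarrow> ('m \<times> 'n \<Rightarrow>\<^sub>0 int) set monoid" where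
  "tensor_product R M ra N la =
     free_Abelian_group (carrier M \<times> carrier N) Mod tensor_kernel R M ra N la"

section \<open>Induced modules\<close>

text \<open>Below, \<open>H\<close> is (the underlying set of) a Lie subalgebra of \<open>L\<close>, and \<open>W\<close> is an \<open>H\<close>-module.
  The module induced from \<open>W\<close> is \<open>U(L) \<otimes>\<^bsub>U(H)\<^esub> W\<close>, on which \<open>U(L)\<close>, and with it \<open>L\<close> and the
  scalars, acts by left multiplication on the first factor.\<close>

definition env_right_mult ::
    "('g, 'x) lie_scheme \<Rightarrow> 'g free_alg set \<Rightarrow> 'g free_alg set \<Rightarrow> 'g free_alg set" where
  "env_right_mult L u X = u \<otimes>\<^bsub>env L\<^esub> env_incl L X"

definition induced_kernel ::
    "('g, 'x) lie_scheme \<Rightarrow> 'g set \<Rightarrow> ('g, 'w, 'y) lie_mod_scheme \<Rightarrow>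
     ('g free_alg set \<times> 'w \<Rightarrow>\<^sub>0 int) set" where
  "induced_kernel L H W =
     tensor_kernel (env (L\<lparr>carrier := H\<rparr>)) (env L) (env_right_mult L) W (env_act W)"

definition induced_group ::
    "('g, 'x) lie_scheme \<Rightarrow> 'g set \<Rightarrow> ('g, 'w, 'y) lie_mod_scheme \<Rightarrow>
     ('g free_alg set \<times> 'w \<Rightarrow>\<^sub>0 int) set monoid" where
  "induced_group L H W =
     tensor_product (env (L\<lparr>carrier := H\<rparr>)) (env L) (env_right_mult L) W (env_act W)"

definition induced_left_mult ::
    "('g, 'x) lie_scheme \<Rightarrow> 'g set \<Rightarrow> ('g, 'w, 'y) lie_mod_scheme \<Rightarrow> 'g free_alg set \<Rightarrow>
     ('g free_alg set \<times> 'w \<Rightarrow>\<^sub>0 int) set \<Rightarrow> ('g free_alg set \<times> 'w \<Rightarrow>\<^sub>0 int) set" where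
  "induced_left_mult L H W a X =
     the_elem ((\<lambda>q. induced_kernel L H W #>\<^bsub>free_Abelian_group (carrier (env L) \<times> carrier W)\<^esub>
                    frag_extend (\<lambda>(u, w). frag_of (a \<otimes>\<^bsub>env L\<^esub> u, w)) q) ` X)"

definition induced_module ::
    "('g, 'x) lie_scheme \<Rightarrow> 'g set \<Rightarrow> ('g, 'w, 'y) lie_mod_scheme \<Rightarrow>
     ('g, ('g free_alg set \<times> 'w \<Rightarrow>\<^sub>0 int) set) lie_mod" where
  "induced_module L H W =
     \<lparr>carrier = carrier (induced_group L H W), monoid.mult = undefined, one = undefined,
      ring.zero = \<one>\<^bsub>induced_group L H W\<^esub>, ring.add = monoid.mult (induced_group L H W),
      module.smult = (\<lambda>c. induced_left_mult L H W (env_class L (free_const c))),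
      act = (\<lambda>x. induced_left_mult L H W (env_class L (free_gen x)))\<rparr>"

section \<open>The Virasoro algebra\<close>

datatype vir_basis = Basis_z | Basis_e int

type_synonym vir = "vir_basis \<Rightarrow>\<^sub>0 complex"

definition vir_z :: vir where "vir_z = Poly_Mapping.single Basis_z 1"

definition vir_e :: "int \<Rightarrow> vir" where "vir_e k = Poly_Mapping.single (Basis_e k) 1"

definition vir_scale :: "complex \<Rightarrow> vir \<Rightarrow> vir" where
  "vir_scale c = Poly_Mapping.map ((*) c)"

lemma lookup_vir_scale: "Poly_Mapping.lookup (vir_scale c x) a = c * Poly_Mapping.lookup x a"
  by (simp add: vir_scale_def map.rep_eq when_def)

interpretation vir: vector_space vir_scale
  by standard (auto intro!: poly_mapping_eqI simp: lookup_vir_scale lookup_add algebra_simps)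

fun basis_bracket :: "vir_basis \<Rightarrow> vir_basis \<Rightarrow> vir" where
  "basis_bracket (Basis_e j) (Basis_e k) =
     vir_scale (of_int (k - j)) (vir_e (j + k))
     + (if k = - j then vir_scale ((of_int j ^ 3 - of_int j) / 12) vir_z else 0)"
| "basis_bracket _ _ = 0"

definition vir_bracket :: "vir \<Rightarrow> vir \<Rightarrow> vir" where
  "vir_bracket x y = (\<Sum>a \<in> Poly_Mapping.keys x. \<Sum>b \<in> Poly_Mapping.keys y.
     vir_scale (Poly_Mapping.lookup x a * Poly_Mapping.lookup y b) (basis_bracket a b))"

definition Vir :: "vir lie" where
  "Vir = \<lparr>carrier = UNIV, monoid.mult = undefined, one = undefined, ring.zero = 0,
     ring.add = (+), module.smult = vir_scale, bracket = vir_bracket\<rparr>"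

definition vir_sub :: "complex \<Rightarrow> vir set" where
  "vir_sub l = vir.span (insert vir_z (range (\<lambda>k. vir_e (k + 1) - vir_scale l (vir_e k))))"

abbreviation Vir_sub :: "complex \<Rightarrow> vir lie" where
  "Vir_sub l \<equiv> Vir\<lparr>carrier := vir_sub l\<rparr>"

definition V_module ::
    "complex \<Rightarrow> (vir \<Rightarrow> complex) \<Rightarrow> (vir, (vir free_alg set \<times> complex \<Rightarrow>\<^sub>0 int) set) lie_mod" where
  "V_module l \<mu> = induced_module Vir (vir_sub l) (char_module \<mu>)"

text \<open>The polynomial \<open>[:a, 1:]\<close> is \<open>\<partial> + a\<close>.\<close>

fun omega_basis_act :: "complex \<Rightarrow> complex \<Rightarrow> vir_basis \<Rightarrow> nat \<Rightarrow> complex poly" where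
  "omega_basis_act l b (Basis_e k) n =
     Polynomial.smult (l powi k) ([:of_int k * (b - 1), 1:] * [:- of_int k, 1:] ^ n)"
| "omega_basis_act l b Basis_z n = 0"

definition omega_act :: "complex \<Rightarrow> complex \<Rightarrow> vir \<Rightarrow> complex poly \<Rightarrow> complex poly" where
  "omega_act l b x f = (\<Sum>a \<in> Poly_Mapping.keys x. \<Sum>n\<le>degree f.
     Polynomial.smult (Poly_Mapping.lookup x a * poly.coeff f n) (omega_basis_act l b a n))"

definition Omega :: "complex \<Rightarrow> complex \<Rightarrow> (vir, complex poly) lie_mod" where
  "Omega l b = \<lparr>carrier = UNIV, monoid.mult = undefined, one = undefined, ring.zero = 0,
     ring.add = (+), module.smult = Polynomial.smult, act = omega_act l b\<rparr>"

definition is_mu :: "complex \<Rightarrow> complex \<Rightarrow> (vir \<Rightarrow> complex) \<Rightarrow> bool" where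
  "is_mu l b \<mu> \<longleftrightarrow> lie_hom (Vir_sub l) abelian_complex \<mu>
     \<and> (\<forall>k::int. \<mu> (vir_e (k + 1) - vir_scale l (vir_e k)) = l powi (k + 1) * (b - 1))
     \<and> \<mu> vir_z = 0"

end

theory Submission
  imports Defs
begin

text \<open>The action of \<open>e\<^sub>0\<close> on \<open>\<Omega>(\<lambda>,b)\<close> is multiplication by \<open>\<partial>\<close>, and an element
  of \<open>Vir\<close> sends the polynomial \<open>1\<close> to a constant if and only if it lies in the subalgebra; that
  constant is \<open>\<mu>\<close>. By Frobenius reciprocity there is a homomorphism \<open>g\<close> from the induced module
  to \<open>\<Omega>\<close> with \<open>g (1 \<otimes> 1) = 1\<close>. Since the subalgebra and \<open>e\<^sub>0\<close> span \<open>Vir\<close>, the vectors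
  \<open>e\<^sub>0\<^sup>n (1 \<otimes> 1)\<close> span a submodule, hence the whole induced module, and \<open>g\<close> sends them to
  the basis \<open>\<partial>\<^sup>n\<close>. So \<open>g\<close> is bijective; the PBW theorem is not needed.\<close>

section \<open>Lie modules\<close>

text \<open>The subalgebra is given as a bare span and \<open>\<mu>\<close> by values on a spanning
  family, so neither closure under the bracket nor consistency of these values is immediate. Both
  are read off from the action on the polynomial 1. The delicate point of the submodule claim is
  that commuting an element h of the subalgebra past e_0 produces [h, e_0], which in general has
  left the subalgebra. The claim is therefore proved for all of \<open>Vir\<close> at once, by
  induction on the polynomial, splitting each element anew. Much of the remaining work comes from
  the encoding: enveloping algebra and tensor product are literal quotients of a free algebra and of
  a free abelian group, so every operation on cosets has to be shown well defined, and the complex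
  scalars of the induced module are left multiplications by constants of the enveloping
  algebra.\<close>

lemma cring_complex_ring: "cring complex_ring"
proof -
  have "\<exists>y. y + x = 0" for x :: complex
    by (rule exI[of _ "- x"]) simp
  then show ?thesis
    by (intro cringI abelian_groupI comm_monoidI) (auto simp: complex_ring_def algebra_simps)
qed

lemma complex_ring_simps [simp]:
  "carrier complex_ring = UNIV" "a \<otimes>\<^bsub>complex_ring\<^esub> b = a * b" "a \<oplus>\<^bsub>complex_ring\<^esub> b = a + b"
  "\<one>\<^bsub>complex_ring\<^esub> = 1" "\<zero>\<^bsub>complex_ring\<^esub> = 0"
  by (simp_all add: complex_ring_def)

lemma complex_ring_uminus [simp]: "\<ominus>\<^bsub>complex_ring\<^esub> a = - a"
  using abelian_group.minus_equality[of complex_ring "- a" a] cring_complex_ring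
  by (simp add: cring_def ring_def)

text \<open>The universal property of the induced module produces maps out of it, whereas the
  isomorphism is wanted from \<Omega> into it; this reverses the arrow.\<close>

lemma lie_module_iso_inv:
  assumes "lie_module_iso L V W f"
  shows "lie_module_iso L W V (inv_into (carrier V) f)"
proof -
  interpret lie_module_iso L V W f by fact
  let ?g = "inv_into (carrier V) f"
  have inj: "inj_on f (carrier V)" and img: "f ` carrier V = carrier W"
    using iso_bij by (auto simp: bij_betw_def)
  have g: "?g w \<in> carrier V" "f (?g w) = w" if "w \<in> carrier W" for w
    using that img by (auto simp: inv_into_into f_inv_into_f)
  have eq: "?g w = v" if "v \<in> carrier V" "f v = w" for v w
    using that inj by auto
  show ?thesis
  proof unfold_locales
    show "bij_betw ?g (carrier W) (carrier V)"
      by (rule bij_betw_inv_into[OF iso_bij])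
  next
    fix v w assume "v \<in> carrier W" "w \<in> carrier W"
    then show "?g (v \<oplus>\<^bsub>W\<^esub> w) = ?g v \<oplus>\<^bsub>V\<^esub> ?g w"
      by (intro eq) (simp_all add: g iso_add)
  next
    fix v c assume "v \<in> carrier W"
    then show "?g (c \<odot>\<^bsub>W\<^esub> v) = c \<odot>\<^bsub>V\<^esub> ?g v"
      by (intro eq) (simp_all add: g iso_smult)
  next
    fix v x assume "v \<in> carrier W" "x \<in> carrier L"
    then show "?g (act W x v) = act V x (?g v)"
      by (intro eq) (simp_all add: g iso_act V.act_closed)
  qed
qed

section \<open>The free algebra and the enveloping algebra\<close>

lemma mem_free_algebra_iff:
  "p \<in> carrier (free_algebra X) \<longleftrightarrow> (\<forall>w \<in> Poly_Mapping.keys p. set (letters w) \<subseteq> X)"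
  by (simp add: free_algebra_def)

lemma free_algebra_simps [simp]:
  "p \<otimes>\<^bsub>free_algebra X\<^esub> q = p * q" "p \<oplus>\<^bsub>free_algebra X\<^esub> q = p + q"
  "\<one>\<^bsub>free_algebra X\<^esub> = 1" "\<zero>\<^bsub>free_algebra X\<^esub> = 0"
  by (simp_all add: free_algebra_def)

lemma letters_simps [simp]: "letters 0 = []" "letters (u + v) = letters u @ letters v"
  by (simp_all add: zero_word_def plus_word_def)

lemma free_algebra_add_closed:
  assumes "p \<in> carrier (free_algebra X)" "q \<in> carrier (free_algebra X)"
  shows "p + q \<in> carrier (free_algebra X)"
  using assms keys_add[of p q] by (auto simp: mem_free_algebra_iff)

lemma free_algebra_mult_closed:
  assumes "p \<in> carrier (free_algebra X)" "q \<in> carrier (free_algebra X)"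
  shows "p * q \<in> carrier (free_algebra X)"
  using assms keys_mult[of p q] by (fastforce simp: mem_free_algebra_iff)

lemma keys_uminus_free_alg: "Poly_Mapping.keys (- p) = Poly_Mapping.keys (p :: 'g free_alg)"
  by (auto simp: in_keys_iff)

lemma single_in_free_algebra:
  "set (letters w) \<subseteq> X \<Longrightarrow> Poly_Mapping.single w c \<in> carrier (free_algebra X)"
  by (simp add: mem_free_algebra_iff)

lemma zero_in_free_algebra: "0 \<in> carrier (free_algebra X)"
  by (simp add: mem_free_algebra_iff)

lemma one_in_free_algebra: "1 \<in> carrier (free_algebra X)"
  by (simp add: mem_free_algebra_iff)

lemma ring_free_algebra: "ring (free_algebra X)"
proof (intro ringI abelian_groupI monoidI)
  fix p :: "'a free_alg" assume "p \<in> carrier (free_algebra X)"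
  then show "\<exists>q\<in>carrier (free_algebra X). q \<oplus>\<^bsub>free_algebra X\<^esub> p = \<zero>\<^bsub>free_algebra X\<^esub>"
    by (intro bexI[of _ "- p"]) (simp_all add: mem_free_algebra_iff keys_uminus_free_alg)
qed (auto simp: free_algebra_add_closed free_algebra_mult_closed zero_in_free_algebra
    one_in_free_algebra algebra_simps)

lemma free_algebra_uminus:
  assumes "p \<in> carrier (free_algebra X)"
  shows "\<ominus>\<^bsub>free_algebra X\<^esub> p = - p"
proof -
  interpret ring "free_algebra X" by (rule ring_free_algebra)
  show ?thesis
    using assms by (intro minus_equality) (simp_all add: mem_free_algebra_iff keys_uminus_free_alg)
qed

lemma free_algebra_minus_closed:
  assumes "p \<in> carrier (free_algebra X)" "q \<in> carrier (free_algebra X)"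
  shows "p - q \<in> carrier (free_algebra X)"
  using free_algebra_add_closed[of p X "- q"] assms by (simp add: mem_free_algebra_iff keys_uminus_free_alg)

lemma poly_mapping_eq_sum_single:
  "(\<Sum>w\<in>Poly_Mapping.keys p. Poly_Mapping.single w (Poly_Mapping.lookup p w)) = p"
proof (rule poly_mapping_eqI)
  fix k
  have "Poly_Mapping.lookup (Poly_Mapping.single w (Poly_Mapping.lookup p w)) k =
      (if k = w then Poly_Mapping.lookup p k else 0)" for w
    by (simp add: lookup_single when_def)
  then show "Poly_Mapping.lookup (\<Sum>w\<in>Poly_Mapping.keys p. Poly_Mapping.single w (Poly_Mapping.lookup p w)) k
      = Poly_Mapping.lookup p k"
    by (simp add: lookup_sum sum.delta in_keys_iff)
qed

text \<open>An element is the sum of its terms, and partial sums over subsets of its support stay in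
  the carrier. Additive statements thus reduce to single words with a coefficient.\<close>

lemma free_algebra_induct [consumes 1, case_names single add]:
  assumes p: "p \<in> carrier (free_algebra X)"
    and single: "\<And>w c. set (letters w) \<subseteq> X \<Longrightarrow> P (Poly_Mapping.single w c)"
    and add: "\<And>p q. \<lbrakk>p \<in> carrier (free_algebra X); q \<in> carrier (free_algebra X); P p; P q\<rbrakk> \<Longrightarrow> P (p + q)"
  shows "P p"
proof -
  let ?s = "\<lambda>w. Poly_Mapping.single w (Poly_Mapping.lookup p w)"
  have *: "sum ?s A \<in> carrier (free_algebra X) \<and> P (sum ?s A)"
    if "finite A" "A \<subseteq> Poly_Mapping.keys p" for A
    using that
  proof (induction A)
    case empty
    \<comment> \<open>Zero is the empty word with coefficient 0, so the case \<open>single\<close>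
      covers it.\<close>
    have "P 0"
      using single[of 0 0] by (simp only: single_zero letters_simps list.set empty_subsetI)
    then show ?case by (simp add: zero_in_free_algebra)
  next
    case (insert w A)
    have w: "?s w \<in> carrier (free_algebra X)" "P (?s w)"
      using insert.prems p by (auto simp: mem_free_algebra_iff intro!: single)
    have A: "sum ?s A \<in> carrier (free_algebra X)" "P (sum ?s A)"
      using insert by auto
    have "sum ?s (insert w A) = ?s w + sum ?s A"
      using insert.hyps by simp
    then show ?case
      using add[OF w(1) A(1) w(2) A(2)] free_algebra_add_closed[OF w(1) A(1)] by (simp only:)
  qed
  show ?thesis
    using *[OF finite_keys order_refl] by (simp only: poly_mapping_eq_sum_single)
qed

section \<open>Classes in the enveloping algebra and the relations between them\<close>

context lie_algebra
begin

abbreviation FA where "FA \<equiv> free_algebra (carrier L)"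

lemma free_gen_closed: "x \<in> carrier L \<Longrightarrow> free_gen x \<in> carrier FA"
  by (simp add: single_in_free_algebra)

lemma free_const_closed: "free_const c \<in> carrier (free_algebra X)"
  by (simp add: single_in_free_algebra)

lemma env_relations_closed: "env_relations L \<subseteq> carrier FA"
  unfolding env_relations_def
  by (auto intro!: free_algebra_minus_closed free_algebra_add_closed free_algebra_mult_closed
      single_in_free_algebra bracket_closed)

lemma ideal_env_ideal: "ideal (env_ideal L) FA"
  unfolding env_ideal_def
  by (rule ring.genideal_ideal[OF ring_free_algebra env_relations_closed])

lemma ring_env: "ring (env L)"
  unfolding env_def by (rule ideal.quotient_is_ring[OF ideal_env_ideal])

lemma env_class_hom: "env_class L \<in> ring_hom FA (env L)"
  using ideal.rcos_ring_hom[OF ideal_env_ideal] by (simp add: env_class_def[abs_def] env_def)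

lemma carrier_env: "carrier (env L) = env_class L ` carrier FA"
  by (auto simp: env_def FactRing_def A_RCOSETS_def' env_class_def)

lemma env_class_closed: "p \<in> carrier FA \<Longrightarrow> env_class L p \<in> carrier (env L)"
  by (simp add: carrier_env)

lemma env_class_add:
  "\<lbrakk>p \<in> carrier FA; q \<in> carrier FA\<rbrakk> \<Longrightarrow>
    env_class L (p + q) = env_class L p \<oplus>\<^bsub>env L\<^esub> env_class L q"
  using ring_hom_add[OF env_class_hom, of p q] by simp

lemma env_class_mult:
  "\<lbrakk>p \<in> carrier FA; q \<in> carrier FA\<rbrakk> \<Longrightarrow>
    env_class L (p * q) = env_class L p \<otimes>\<^bsub>env L\<^esub> env_class L q"
  using ring_hom_mult[OF env_class_hom, of p q] by simp

lemma env_class_one: "env_class L 1 = \<one>\<^bsub>env L\<^esub>"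
  using ring_hom_one[OF env_class_hom] by simp

lemma env_ideal_closed: "p \<in> env_ideal L \<Longrightarrow> p \<in> carrier FA"
  using ideal.Icarr[OF ideal_env_ideal] by blast

lemma mem_env_class_iff:
  assumes "p \<in> carrier FA"
  shows "q \<in> env_class L p \<longleftrightarrow> q \<in> carrier FA \<and> q - p \<in> env_ideal L"
proof
  assume "q \<in> env_class L p"
  then obtain h where h: "h \<in> env_ideal L" "q = h + p"
    by (auto simp: env_class_def a_r_coset_def')
  then show "q \<in> carrier FA \<and> q - p \<in> env_ideal L"
    using free_algebra_add_closed[OF env_ideal_closed[OF h(1)] assms] by simp
next
  assume "q \<in> carrier FA \<and> q - p \<in> env_ideal L"
  then show "q \<in> env_class L p"
    by (auto simp: env_class_def a_r_coset_def' intro!: bexI[of _ "q - p"])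
qed

lemma env_class_self: "p \<in> carrier FA \<Longrightarrow> p \<in> env_class L p"
  using additive_subgroup.zero_closed[OF ideal.axioms(1)[OF ideal_env_ideal]]
  by (subst mem_env_class_iff) auto

lemma env_class_eqI:
  assumes "p \<in> carrier FA" "q \<in> carrier FA" "p - q \<in> env_ideal L"
  shows "env_class L p = env_class L q"
proof -
  interpret ideal "env_ideal L" FA by (rule ideal_env_ideal)
  have "p \<in> env_class L q"
    using assms by (simp add: mem_env_class_iff)
  then show ?thesis
    using a_repr_independence[of p "env_ideal L" q] assms a_subgroup
    by (simp add: env_class_def)
qed

lemma env_relations_sub_env_ideal: "env_relations L \<subseteq> env_ideal L"
  unfolding env_ideal_def by (rule ring.genideal_self[OF ring_free_algebra env_relations_closed])

lemma env_class_gen_add: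
  assumes "x \<in> carrier L" "y \<in> carrier L"
  shows "env_class L (free_gen (x \<oplus> y)) = env_class L (free_gen x) \<oplus>\<^bsub>env L\<^esub> env_class L (free_gen y)"
proof -
  have "env_class L (free_gen (x \<oplus> y)) = env_class L (free_gen x + free_gen y)"
    using assms
    by (intro env_class_eqI subsetD[OF env_relations_sub_env_ideal] free_algebra_add_closed
        single_in_free_algebra) (auto simp: env_relations_def)
  then show ?thesis
    using assms by (simp add: env_class_add free_gen_closed)
qed

lemma env_class_gen_smult:
  assumes "x \<in> carrier L"
  shows "env_class L (free_gen (c \<odot>\<^bsub>L\<^esub> x)) = env_class L (free_const c) \<otimes>\<^bsub>env L\<^esub> env_class L (free_gen x)"
proof -
  have "env_class L (free_gen (c \<odot>\<^bsub>L\<^esub> x)) = env_class L (free_const c * free_gen x)"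
    using assms
    by (intro env_class_eqI subsetD[OF env_relations_sub_env_ideal] free_algebra_mult_closed
        single_in_free_algebra) (auto simp: env_relations_def)
  then show ?thesis
    using assms by (simp add: env_class_mult free_gen_closed free_const_closed)
qed

text \<open>The product in the opposite order is moved to the other side, so that only sums and
  products of classes occur and no negation in the quotient ring.\<close>

lemma env_class_gen_bracket:
  assumes "x \<in> carrier L" "y \<in> carrier L"
  shows "env_class L (free_gen (bracket L x y)) \<oplus>\<^bsub>env L\<^esub> env_class L (free_gen y) \<otimes>\<^bsub>env L\<^esub> env_class L (free_gen x)
    = env_class L (free_gen x) \<otimes>\<^bsub>env L\<^esub> env_class L (free_gen y)"
proof -
  let ?x = "free_gen x" and ?y = "free_gen y" and ?b = "free_gen (bracket L x y)"
  have cl: "?x \<in> carrier FA" "?y \<in> carrier FA" "?b \<in> carrier FA"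
    using assms by (simp_all add: bracket_closed free_gen_closed)
  note cl' = cl free_algebra_mult_closed[OF cl(1,2)] free_algebra_mult_closed[OF cl(2,1)]
  have "env_class L (?x * ?y) = env_class L (?b + ?y * ?x)"
  proof (intro env_class_eqI subsetD[OF env_relations_sub_env_ideal] free_algebra_add_closed cl')
    have "?x * ?y - (?b + ?y * ?x) = ?x * ?y - ?y * ?x - ?b"
      by simp
    moreover have "?x * ?y - ?y * ?x - ?b \<in> env_relations L"
      using assms unfolding env_relations_def by blast
    ultimately show "?x * ?y - (?b + ?y * ?x) \<in> env_relations L"
      by (simp only:)
  qed
  then show ?thesis
    using cl' by (simp add: env_class_mult env_class_add)
qed

text \<open>Constants sit on the empty word, the neutral element of concatenation, so they are
  central already in the free algebra. In the induced module this makes the action of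
  \<open>L\<close> commute with the scalars.\<close>

lemma env_class_const_commute:
  assumes "p \<in> carrier FA"
  shows "env_class L (free_const c) \<otimes>\<^bsub>env L\<^esub> env_class L p = env_class L p \<otimes>\<^bsub>env L\<^esub> env_class L (free_const c)"
proof -
  have "free_const c * p = p * free_const c"
    using assms
  proof (induction p rule: free_algebra_induct)
    case (single w d)
    then show ?case by (simp add: mult_single mult.commute)
  next
    case (add p q)
    then show ?case by (simp add: algebra_simps)
  qed
  then show ?thesis
    using assms by (simp add: free_const_closed flip: env_class_mult)
qed

end

section \<open>The action of the enveloping algebra on a module\<close>

context lie_module
begin

lemma foldr_act_closed:
  "\<lbrakk>set xs \<subseteq> carrier L; v \<in> carrier V\<rbrakk> \<Longrightarrow> foldr (act V) xs v \<in> carrier V"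
  by (induction xs) (auto intro: act_closed)

lemma foldr_act_add:
  "\<lbrakk>set xs \<subseteq> carrier L; v \<in> carrier V; w \<in> carrier V\<rbrakk> \<Longrightarrow>
    foldr (act V) xs (v \<oplus>\<^bsub>V\<^esub> w) = foldr (act V) xs v \<oplus>\<^bsub>V\<^esub> foldr (act V) xs w"
  by (induction xs) (auto simp: act_add_right foldr_act_closed)

lemma foldr_act_smult:
  "\<lbrakk>set xs \<subseteq> carrier L; v \<in> carrier V\<rbrakk> \<Longrightarrow>
    foldr (act V) xs (c \<odot>\<^bsub>V\<^esub> v) = c \<odot>\<^bsub>V\<^esub> foldr (act V) xs v"
  by (induction xs) (auto simp: act_smult_right foldr_act_closed)

text \<open>Words outside the support contribute 0. This brings sums over different supports to one
  index set, as additivity requires: the support of a sum can be smaller than the union.\<close>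

lemma free_act_eq_finsum:
  assumes "finite S" "Poly_Mapping.keys p \<subseteq> S" "\<And>w. w \<in> S \<Longrightarrow> set (letters w) \<subseteq> carrier L"
    and "v \<in> carrier V"
  shows "free_act V p v =
    (\<Oplus>\<^bsub>V\<^esub> w \<in> S. Poly_Mapping.lookup p w \<odot>\<^bsub>V\<^esub> foldr (act V) (letters w) v)"
  unfolding free_act_def using assms
  by (intro V.M.add.finprod_mono_neutral_cong_left)
    (auto simp: in_keys_iff foldr_act_closed V.smult_l_null[simplified] intro!: V.smult_closed)

lemma free_act_single:
  assumes "set (letters w) \<subseteq> carrier L" "v \<in> carrier V"
  shows "free_act V (Poly_Mapping.single w c) v = c \<odot>\<^bsub>V\<^esub> foldr (act V) (letters w) v"
  using assms free_act_eq_finsum[of "{w}" "Poly_Mapping.single w c" v]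
  by (simp add: foldr_act_closed V.smult_closed V.M.finsum_insert)

lemma free_act_closed:
  "\<lbrakk>p \<in> carrier L.FA; v \<in> carrier V\<rbrakk> \<Longrightarrow> free_act V p v \<in> carrier V"
  unfolding free_act_def by (intro V.M.finsum_closed) (auto simp: mem_free_algebra_iff foldr_act_closed intro!: V.smult_closed)

lemma free_act_add_left:
  assumes "p \<in> carrier L.FA" "q \<in> carrier L.FA" "v \<in> carrier V"
  shows "free_act V (p + q) v = free_act V p v \<oplus>\<^bsub>V\<^esub> free_act V q v"
proof -
  let ?S = "Poly_Mapping.keys p \<union> Poly_Mapping.keys q"
  let ?f = "\<lambda>p w. Poly_Mapping.lookup p w \<odot>\<^bsub>V\<^esub> foldr (act V) (letters w) v"
  have S: "set (letters w) \<subseteq> carrier L" if "w \<in> ?S" for w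
    using assms that by (auto simp: mem_free_algebra_iff)
  have cl: "?f r \<in> ?S \<rightarrow> carrier V" for r
    using S assms(3) by (auto simp: foldr_act_closed intro!: V.smult_closed)
  have "free_act V (p + q) v = (\<Oplus>\<^bsub>V\<^esub> w \<in> ?S. ?f (p + q) w)"
    using S keys_add[of p q] assms by (intro free_act_eq_finsum) auto
  also have "\<dots> = (\<Oplus>\<^bsub>V\<^esub> w \<in> ?S. ?f p w \<oplus>\<^bsub>V\<^esub> ?f q w)"
  proof (intro V.M.finsum_cong' refl)
    show "(\<lambda>w. ?f p w \<oplus>\<^bsub>V\<^esub> ?f q w) \<in> ?S \<rightarrow> carrier V"
      using cl[of p] cl[of q] by auto
    show "?f (p + q) w = ?f p w \<oplus>\<^bsub>V\<^esub> ?f q w" if "w \<in> ?S" for w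
      using V.smult_l_distr[of "Poly_Mapping.lookup p w" "Poly_Mapping.lookup q w"] S[OF that] assms
      by (simp add: lookup_add foldr_act_closed)
  qed
  also have "\<dots> = (\<Oplus>\<^bsub>V\<^esub> w \<in> ?S. ?f p w) \<oplus>\<^bsub>V\<^esub> (\<Oplus>\<^bsub>V\<^esub> w \<in> ?S. ?f q w)"
    by (rule V.M.finsum_addf[OF cl cl])
  also have "\<dots> = free_act V p v \<oplus>\<^bsub>V\<^esub> free_act V q v"
    using S assms by (subst (1 2) free_act_eq_finsum[of ?S]) auto
  finally show ?thesis .
qed

lemma free_act_add_right:
  assumes "p \<in> carrier L.FA" "v \<in> carrier V" "w \<in> carrier V"
  shows "free_act V p (v \<oplus>\<^bsub>V\<^esub> w) = free_act V p v \<oplus>\<^bsub>V\<^esub> free_act V p w"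
  using assms(1)
proof (induction p rule: free_algebra_induct)
  case (single u c)
  then show ?case
    using assms by (simp add: free_act_single foldr_act_add foldr_act_closed V.smult_r_distr)
next
  case (add p q)
  then show ?case
    using assms by (simp add: free_act_add_left free_act_closed V.M.a_ac)
qed

text \<open>For two words, \<open>foldr\<close> turns concatenation into composition, and the inner
  coefficient passes through the outer word by linearity; the rest is additivity in each
  factor.\<close>

lemma free_act_mult:
  assumes "p \<in> carrier L.FA" "q \<in> carrier L.FA" "v \<in> carrier V"
  shows "free_act V (p * q) v = free_act V p (free_act V q v)"
  using assms(1)
proof (induction p rule: free_algebra_induct)
  case (single u c)
  note u = single
  show ?case
    using assms(2)
  proof (induction q rule: free_algebra_induct)
    case (single w d)
    then show ?case
      using assms(3) u V.smult_assoc1[of c d]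
      by (simp add: free_act_single mult_single foldr_act_smult foldr_act_closed)
  next
    case (add p q)
    have "Poly_Mapping.single u c \<in> carrier L.FA"
      using u by (rule single_in_free_algebra)
    then show ?case
      using add assms(3)
      by (simp add: distrib_left free_act_add_left free_act_add_right free_act_closed
          free_algebra_mult_closed)
  qed
next
  case (add p p')
  then show ?case
    using assms
    by (simp add: distrib_right free_act_add_left free_act_closed
          free_algebra_mult_closed)
qed

lemma free_act_const: "v \<in> carrier V \<Longrightarrow> free_act V (free_const c) v = c \<odot>\<^bsub>V\<^esub> v"
  by (simp add: free_act_single)

lemma free_act_gen: "\<lbrakk>x \<in> carrier L; v \<in> carrier V\<rbrakk> \<Longrightarrow> free_act V (free_gen x) v = act V x v"
  using V.smult_one by (simp add: free_act_single act_closed)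

lemma free_act_diff_eq_zero:
  assumes "p \<in> carrier L.FA" "q \<in> carrier L.FA" "v \<in> carrier V"
  shows "free_act V (p - q) v = \<zero>\<^bsub>V\<^esub> \<longleftrightarrow> free_act V p v = free_act V q v"
proof -
  note d = free_algebra_minus_closed[OF assms(1,2)]
  have "free_act V p v = free_act V (p - q) v \<oplus>\<^bsub>V\<^esub> free_act V q v"
    using free_act_add_left[OF d assms(2,3)] by simp
  then show ?thesis
    using V.M.add.r_cancel_one[OF free_act_closed[OF assms(2,3)] free_act_closed[OF d assms(3)]]
    by simp
qed

lemma free_act_relation:
  assumes "r \<in> env_relations L" "v \<in> carrier V"
  shows "free_act V r v = \<zero>\<^bsub>V\<^esub>"
proof -
  note cl = L.free_gen_closed L.free_const_closed[of _ "carrier L"] free_algebra_add_closed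
    free_algebra_mult_closed L.bracket_closed act_closed
  \<comment> \<open>The commutator relation is regrouped as a difference of two elements, the shape
    to which \<open>free_act_diff_eq_zero\<close> applies.\<close>
  from assms(1) consider
    (a) x y where "r = free_gen (x \<oplus>\<^bsub>L\<^esub> y) - (free_gen x + free_gen y)" "x \<in> carrier L" "y \<in> carrier L"
  | (s) c x where "r = free_gen (c \<odot>\<^bsub>L\<^esub> x) - free_const c * free_gen x" "x \<in> carrier L"
  | (b) x y where "r = free_gen x * free_gen y - (free_gen (bracket L x y) + free_gen y * free_gen x)"
      "x \<in> carrier L" "y \<in> carrier L"
    unfolding env_relations_def by (auto simp: algebra_simps) 
  then show ?thesis
  proof cases
    case a
    then show ?thesis
      using assms(2)
      by (simp add: free_act_diff_eq_zero cl free_act_add_left free_act_gen act_add_left)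
  next
    case s
    then show ?thesis
      using assms(2) L.smult_closed
      by (simp add: free_act_diff_eq_zero cl free_act_mult free_act_gen free_act_const act_smult_left)
  next
    case b
    have "act V x (act V y v) \<ominus>\<^bsub>V\<^esub> act V y (act V x v) \<oplus>\<^bsub>V\<^esub> act V y (act V x v) = act V x (act V y v)"
      using b assms(2) by (simp add: V.M.minus_eq V.M.a_assoc V.M.l_neg act_closed)
    then show ?thesis
      using assms(2) b
      by (simp add: free_act_diff_eq_zero cl free_act_add_left free_act_mult free_act_gen act_bracket)
  qed
qed

text \<open>The annihilator \<open>J\<close> of \<open>V\<close> is a two-sided ideal containing the
  defining relations, hence it contains the ideal generated by them.\<close>

lemma free_act_env_ideal:
  assumes "p \<in> env_ideal L" "v \<in> carrier V"
  shows "free_act V p v = \<zero>\<^bsub>V\<^esub>"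
proof -
  define J where "J = {p \<in> carrier L.FA. \<forall>v\<in>carrier V. free_act V p v = \<zero>\<^bsub>V\<^esub>}"
  interpret F: ring L.FA by (rule ring_free_algebra)
  \<comment> \<open>Needed for products with an annihilating right factor: the left factor then acts
    on the zero vector.\<close>
  have zero: "free_act V p \<zero>\<^bsub>V\<^esub> = \<zero>\<^bsub>V\<^esub>" if "p \<in> carrier L.FA" for p
    using free_act_add_right[OF that V.M.zero_closed V.M.zero_closed]
      V.M.add.r_cancel_one'[OF free_act_closed[OF that V.M.zero_closed]
        free_act_closed[OF that V.M.zero_closed]]
    by simp
  have "subgroup J (add_monoid L.FA)"
  proof (rule F.add.subgroupI)
    show "J \<subseteq> carrier L.FA"
      by (auto simp: J_def)
    have "free_act V 0 v = \<zero>\<^bsub>V\<^esub>" for v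
      by (simp add: free_act_def)
    then have "0 \<in> J"
      by (simp add: J_def zero_in_free_algebra)
    then show "J \<noteq> {}" by blast
    show "\<ominus>\<^bsub>L.FA\<^esub> p \<in> J" if "p \<in> J" for p
    proof -
      have p: "p \<in> carrier L.FA" and p0: "\<And>v. v \<in> carrier V \<Longrightarrow> free_act V p v = \<zero>\<^bsub>V\<^esub>"
        using that by (auto simp: J_def)
      have "free_act V (- p) v = \<zero>\<^bsub>V\<^esub>" if "v \<in> carrier V" for v
        using free_act_diff_eq_zero[OF F.zero_closed p that] that p0 by (simp add: \<open>free_act V 0 v = \<zero>\<^bsub>V\<^esub>\<close>)
      then show ?thesis
        using free_algebra_minus_closed[OF F.zero_closed p] p by (simp add: J_def free_algebra_uminus)
    qed
    show "p \<oplus>\<^bsub>L.FA\<^esub> q \<in> J" if "p \<in> J" "q \<in> J" for p q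
      using that by (simp add: J_def free_act_add_left free_algebra_add_closed)
  qed
  then have "ideal J L.FA"
    by (intro idealI ring_free_algebra)
      (auto simp: J_def free_act_mult free_algebra_mult_closed free_act_closed zero)
  moreover have "env_relations L \<subseteq> J"
    using L.env_relations_closed by (auto simp: J_def free_act_relation)
  ultimately have "env_ideal L \<subseteq> J"
    unfolding env_ideal_def by (rule F.genideal_minimal)
  then show ?thesis
    using assms by (auto simp: J_def)
qed

text \<open>Representatives of one class differ by an element of the ideal, which annihilates
  \<open>V\<close>; so the image of the coset is a singleton and \<open>the_elem\<close> returns its
  value.\<close>

lemma env_act_class:
  assumes "p \<in> carrier L.FA" "v \<in> carrier V"
  shows "env_act V (env_class L p) v = free_act V p v"
  unfolding env_act_def
proof (rule the_elem_image_unique)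
  show "env_class L p \<noteq> {}"
    using L.env_class_self[OF assms(1)] by blast
  show "free_act V q v = free_act V p v" if "q \<in> env_class L p" for q
    using that assms
    by (simp add: L.mem_env_class_iff free_act_env_ideal flip: free_act_diff_eq_zero)
qed

lemma env_act_closed:
  "\<lbrakk>u \<in> carrier (env L); v \<in> carrier V\<rbrakk> \<Longrightarrow> env_act V u v \<in> carrier V"
  by (auto simp: L.carrier_env env_act_class free_act_closed)

lemma env_act_add_left:
  "\<lbrakk>u \<in> carrier (env L); u' \<in> carrier (env L); v \<in> carrier V\<rbrakk> \<Longrightarrow>
    env_act V (u \<oplus>\<^bsub>env L\<^esub> u') v = env_act V u v \<oplus>\<^bsub>V\<^esub> env_act V u' v"
  by (auto simp: L.carrier_env env_act_class free_act_add_left free_algebra_add_closed simp flip: L.env_class_add)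

lemma env_act_add_right:
  "\<lbrakk>u \<in> carrier (env L); v \<in> carrier V; w \<in> carrier V\<rbrakk> \<Longrightarrow>
    env_act V u (v \<oplus>\<^bsub>V\<^esub> w) = env_act V u v \<oplus>\<^bsub>V\<^esub> env_act V u w"
  by (auto simp: L.carrier_env env_act_class free_act_add_right)

lemma env_act_mult:
  "\<lbrakk>u \<in> carrier (env L); u' \<in> carrier (env L); v \<in> carrier V\<rbrakk> \<Longrightarrow>
    env_act V (u \<otimes>\<^bsub>env L\<^esub> u') v = env_act V u (env_act V u' v)"
  by (auto simp: L.carrier_env env_act_class free_act_mult free_act_closed free_algebra_mult_closed simp flip: L.env_class_mult)

lemma env_act_const: "v \<in> carrier V \<Longrightarrow> env_act V (env_class L (free_const c)) v = c \<odot>\<^bsub>V\<^esub> v"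
  by (simp add: env_act_class free_act_const L.free_const_closed)

lemma env_act_gen:
  "\<lbrakk>x \<in> carrier L; v \<in> carrier V\<rbrakk> \<Longrightarrow> env_act V (env_class L (free_gen x)) v = act V x v"
  by (simp add: env_act_class free_act_gen L.free_gen_closed)

lemma env_act_one: "v \<in> carrier V \<Longrightarrow> env_act V \<one>\<^bsub>env L\<^esub> v = v"
  using env_act_const[of v 1] V.smult_one by (simp add: L.env_class_one)

end

section \<open>Induced modules\<close>

lemma free_algebra_mono: "X \<subseteq> Y \<Longrightarrow> p \<in> carrier (free_algebra X) \<Longrightarrow> p \<in> carrier (free_algebra Y)"
  by (auto simp: mem_free_algebra_iff)

lemma additive_minus:
  assumes "abelian_group A" "abelian_group B"
    and "\<And>v. v \<in> carrier A \<Longrightarrow> f v \<in> carrier B"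
    and "\<And>v v'. \<lbrakk>v \<in> carrier A; v' \<in> carrier A\<rbrakk> \<Longrightarrow> f (v \<oplus>\<^bsub>A\<^esub> v') = f v \<oplus>\<^bsub>B\<^esub> f v'"
    and "v \<in> carrier A" "v' \<in> carrier A"
  shows "f (v \<ominus>\<^bsub>A\<^esub> v') = f v \<ominus>\<^bsub>B\<^esub> f v'"
proof -
  interpret A: abelian_group A by fact
  interpret B: abelian_group B by fact
  interpret abelian_group_hom A B f
    using assms A.a_group B.a_group
    by (intro abelian_group_homI) (auto simp: group_hom_def group_hom_axioms_def hom_def A.abelian_group_axioms B.abelian_group_axioms)
  show ?thesis
    using assms by (simp add: A.minus_eq B.minus_eq)
qed

text \<open>Closure of \<open>H\<close> under the operations of \<open>L\<close> is contained in the
  assumption on \<open>W\<close>, which includes that \<open>L\<close> with carrier \<open>H\<close>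
  is a Lie algebra; the inclusion is all that remains to be said.\<close>

locale subalgebra_module = L: lie_algebra L + W: lie_module "L\<lparr>carrier := H\<rparr>" W
  for L :: "('g, 'x) lie_scheme" and H :: "'g set" and W :: "('g, 'w, 'y) lie_mod_scheme" +
  assumes subalgebra: "H \<subseteq> carrier L"
begin

lemma env_relations_subalgebra: "env_relations (L\<lparr>carrier := H\<rparr>) \<subseteq> env_relations L"
proof -
  have "x \<in> carrier L" if "x \<in> carrier (L\<lparr>carrier := H\<rparr>)" for x
    using that subalgebra by auto
  then show ?thesis
    unfolding env_relations_def by (intro Un_mono subsetI; elim CollectE exE conjE; simp; blast)
qed

text \<open>Intersecting \<open>env_ideal L\<close> with the free algebra on \<open>H\<close> gives
  an ideal there that contains the relations of \<open>H\<close>, so minimality applies. The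
  inclusion makes \<open>env_incl\<close> well defined on cosets.\<close>

lemma env_ideal_subalgebra: "env_ideal (L\<lparr>carrier := H\<rparr>) \<subseteq> env_ideal L"
proof -
  interpret I: ideal "env_ideal L" L.FA by (rule L.ideal_env_ideal)
  note A = I.is_additive_subgroup
  interpret F: ring "free_algebra H" by (rule ring_free_algebra)
  let ?J = "env_ideal L \<inter> carrier (free_algebra H)"
  note mono = free_algebra_mono[OF subalgebra]
  have "subgroup ?J (add_monoid (free_algebra H))"
  proof (rule F.add.subgroupI)
    have "0 \<in> ?J"
      using additive_subgroup.zero_closed[OF A] zero_in_free_algebra by simp
    then show "?J \<noteq> {}" by blast
    fix p assume p: "p \<in> ?J"
    then have "\<ominus>\<^bsub>free_algebra H\<^esub> p = \<ominus>\<^bsub>L.FA\<^esub> p"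
      using mono by (simp add: free_algebra_uminus)
    then show "\<ominus>\<^bsub>free_algebra H\<^esub> p \<in> ?J"
      using p additive_subgroup.a_inv_closed[OF A, of p] F.a_inv_closed[of p] by simp
  next
    fix p q assume "p \<in> ?J" "q \<in> ?J"
    then show "p \<oplus>\<^bsub>free_algebra H\<^esub> q \<in> ?J"
      using additive_subgroup.a_closed[OF A, of p q] by (simp add: free_algebra_add_closed)
  qed auto
  then have "ideal ?J (free_algebra H)"
  proof (intro idealI ring_free_algebra)
    fix p q assume "p \<in> ?J" "q \<in> carrier (free_algebra H)"
    then show "q \<otimes>\<^bsub>free_algebra H\<^esub> p \<in> ?J" "p \<otimes>\<^bsub>free_algebra H\<^esub> q \<in> ?J"
      using I.I_l_closed[of p q] I.I_r_closed[of p q] mono[of q]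
      by (simp_all add: free_algebra_mult_closed)
  qed
  moreover have "env_relations (L\<lparr>carrier := H\<rparr>) \<subseteq> ?J"
    using env_relations_subalgebra L.env_relations_sub_env_ideal W.L.env_relations_closed by auto
  ultimately have "env_ideal (L\<lparr>carrier := H\<rparr>) \<subseteq> ?J"
    unfolding env_ideal_def[of "L\<lparr>carrier := H\<rparr>"] using F.genideal_minimal[of ?J] by simp
  then show ?thesis by blast
qed

lemma env_incl_class:
  assumes "p \<in> carrier (free_algebra H)"
  shows "env_incl L (env_class (L\<lparr>carrier := H\<rparr>) p) = env_class L p"
  unfolding env_incl_def
proof (rule the_elem_image_unique)
  have p: "p \<in> carrier W.L.FA"
    using assms by simp
  then show "env_class (L\<lparr>carrier := H\<rparr>) p \<noteq> {}"
    using W.L.env_class_self by blast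
  show "env_class L q = env_class L p" if "q \<in> env_class (L\<lparr>carrier := H\<rparr>) p" for q
    using that env_ideal_subalgebra assms free_algebra_mono[OF subalgebra]
    by (intro L.env_class_eqI) (auto simp: W.L.mem_env_class_iff[OF p])
qed

lemma env_incl_closed:
  "X \<in> carrier (env (L\<lparr>carrier := H\<rparr>)) \<Longrightarrow> env_incl L X \<in> carrier (env L)"
  using free_algebra_mono[OF subalgebra]
  by (auto simp: W.L.carrier_env env_incl_class L.env_class_closed)

section \<open>The induced module as a quotient of a free abelian group\<close>

abbreviation FG where "FG \<equiv> free_Abelian_group (carrier (env L) \<times> carrier W)"

abbreviation coset where "coset q \<equiv> induced_kernel L H W #>\<^bsub>FG\<^esub> q"

definition tens :: "'g free_alg set \<Rightarrow> 'w \<Rightarrow> ('g free_alg set \<times> 'w \<Rightarrow>\<^sub>0 int) set" where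
  "tens u w = coset (frag_of (u, w))"

abbreviation Ind where "Ind \<equiv> induced_module L H W"

abbreviation left_ext where
  "left_ext a \<equiv> frag_extend (\<lambda>(u, w). frag_of (a \<otimes>\<^bsub>env L\<^esub> u, w))"

sublocale U: ring "env L" by (rule L.ring_env)

sublocale FG: comm_group FG by (rule abelian_free_Abelian_group)

lemma FG_add_closed: "\<lbrakk>p \<in> carrier FG; q \<in> carrier FG\<rbrakk> \<Longrightarrow> p + q \<in> carrier FG"
  using keys_add[of p q] by auto

lemma FG_diff_closed: "\<lbrakk>p \<in> carrier FG; q \<in> carrier FG\<rbrakk> \<Longrightarrow> p - q \<in> carrier FG"
  using keys_diff[of p q] by auto

lemma FG_frag_of_closed: "\<lbrakk>u \<in> carrier (env L); w \<in> carrier W\<rbrakk> \<Longrightarrow> frag_of (u, w) \<in> carrier FG"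
  by simp

abbreviation rels where
  "rels \<equiv> tensor_relations (env (L\<lparr>carrier := H\<rparr>)) (env L) (env_right_mult L) W (env_act W)"

lemma env_right_mult_closed:
  "\<lbrakk>u \<in> carrier (env L); r \<in> carrier (env (L\<lparr>carrier := H\<rparr>))\<rbrakk> \<Longrightarrow> env_right_mult L u r \<in> carrier (env L)"
  by (simp add: env_right_mult_def env_incl_closed)

lemma rels_closed: "rels \<subseteq> carrier FG"
  unfolding tensor_relations_def
  by (auto intro!: FG_diff_closed FG_add_closed FG_frag_of_closed W.env_act_closed env_right_mult_closed
      simp del: carrier_free_Abelian_group_iff)

lemma kernel_generate: "induced_kernel L H W = generate FG rels"
  by (simp add: induced_kernel_def tensor_kernel_def)

lemma kernel_subgroup: "subgroup (induced_kernel L H W) FG"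
  unfolding kernel_generate by (rule FG.generate_is_subgroup[OF rels_closed])

lemma kernel_normal: "induced_kernel L H W \<lhd> FG"
  using FG.subgroup_imp_normal[OF kernel_subgroup] .

lemma rels_kernel: "r \<in> rels \<Longrightarrow> r \<in> induced_kernel L H W"
  unfolding kernel_generate by (rule generate.incl)

lemma kernel_closed: "q \<in> induced_kernel L H W \<Longrightarrow> q \<in> carrier FG"
  using subgroup.subset[OF kernel_subgroup] by blast

lemma mem_coset_iff:
  assumes "p \<in> carrier FG"
  shows "q \<in> coset p \<longleftrightarrow> q \<in> carrier FG \<and> q - p \<in> induced_kernel L H W"
proof
  assume "q \<in> coset p"
  then obtain h where h: "h \<in> induced_kernel L H W" "q = h + p"
    by (auto simp: r_coset_def)
  then show "q \<in> carrier FG \<and> q - p \<in> induced_kernel L H W"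
    using FG_add_closed[OF kernel_closed[OF h(1)] assms] by simp
next
  assume "q \<in> carrier FG \<and> q - p \<in> induced_kernel L H W"
  then show "q \<in> coset p"
    by (auto simp: r_coset_def intro!: bexI[of _ "q - p"])
qed

lemma coset_self: "p \<in> carrier FG \<Longrightarrow> p \<in> coset p"
  using subgroup.one_closed[OF kernel_subgroup] by (subst mem_coset_iff) auto

lemma coset_eqI:
  assumes "p \<in> carrier FG" "q \<in> carrier FG" "p - q \<in> induced_kernel L H W"
  shows "coset p = coset q"
  using FG.repr_independence[of p "induced_kernel L H W" q] assms kernel_subgroup
  by (simp add: mem_coset_iff)

lemma carrier_Ind: "carrier Ind = coset ` carrier FG"
  by (auto simp: induced_module_def induced_group_def tensor_product_def carrier_FactGroup
      induced_kernel_def)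

lemma add_Ind:
  "\<lbrakk>p \<in> carrier FG; q \<in> carrier FG\<rbrakk> \<Longrightarrow> coset p \<oplus>\<^bsub>Ind\<^esub> coset q = coset (p + q)"
  using normal.rcos_sum[OF kernel_normal, of p q]
  by (simp add: induced_module_def induced_group_def tensor_product_def induced_kernel_def)

lemma abelian_group_Ind: "abelian_group Ind"
proof -
  interpret Q: comm_group "induced_group L H W"
    unfolding induced_group_def tensor_product_def
    using FG.abelian_FactGroup[OF kernel_subgroup] by (simp add: induced_kernel_def)
  show ?thesis
    by (intro abelian_groupI)
      (auto simp: induced_module_def Q.m_ac intro: Q.l_inv_ex)
qed

sublocale Ind: abelian_group Ind by (rule abelian_group_Ind)

section \<open>Left multiplication on the tensor product\<close>

lemma left_ext_closed:
  assumes "a \<in> carrier (env L)" "q \<in> carrier FG"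
  shows "left_ext a q \<in> carrier FG"
  using keys_frag_extend[of "\<lambda>(u, w). frag_of (a \<otimes>\<^bsub>env L\<^esub> u, w)" q] assms
  by (fastforce simp: keys_frag_of)

text \<open>Left multiplication by \<open>a\<close> is additive and commutes with the right action
  by associativity, so it sends each relation to a relation of the same kind. The elements sent into
  the kernel form a subgroup, which therefore contains everything the relations generate.\<close>

lemma left_ext_kernel:
  assumes a: "a \<in> carrier (env L)" and "q \<in> induced_kernel L H W"
  shows "left_ext a q \<in> induced_kernel L H W"
proof -
  let ?J = "{q \<in> carrier FG. left_ext a q \<in> induced_kernel L H W}"
  have rels: "left_ext a r \<in> rels" if "r \<in> rels" for r
  proof -
    from that consider
      (l) u u' w where "r = frag_of (u \<oplus>\<^bsub>env L\<^esub> u', w) - (frag_of (u, w) + frag_of (u', w))"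
        "u \<in> carrier (env L)" "u' \<in> carrier (env L)" "w \<in> carrier W"
    | (r) u w w' where "r = frag_of (u, w \<oplus>\<^bsub>W\<^esub> w') - (frag_of (u, w) + frag_of (u, w'))"
        "u \<in> carrier (env L)" "w \<in> carrier W" "w' \<in> carrier W"
    | (b) u x w where "r = frag_of (env_right_mult L u x, w) - frag_of (u, env_act W x w)"
        "u \<in> carrier (env L)" "x \<in> carrier (env (L\<lparr>carrier := H\<rparr>))" "w \<in> carrier W"
      unfolding tensor_relations_def by blast
    then show ?thesis
    proof cases
      case l
      then have "left_ext a r = frag_of (a \<otimes>\<^bsub>env L\<^esub> u \<oplus>\<^bsub>env L\<^esub> a \<otimes>\<^bsub>env L\<^esub> u', w) -
          (frag_of (a \<otimes>\<^bsub>env L\<^esub> u, w) + frag_of (a \<otimes>\<^bsub>env L\<^esub> u', w))"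
        using a by (simp add: frag_extend_diff frag_extend_add U.r_distr)
      then show ?thesis
        unfolding tensor_relations_def using l a U.m_closed by blast
    next
      case r
      then have "left_ext a r = frag_of (a \<otimes>\<^bsub>env L\<^esub> u, w \<oplus>\<^bsub>W\<^esub> w') -
          (frag_of (a \<otimes>\<^bsub>env L\<^esub> u, w) + frag_of (a \<otimes>\<^bsub>env L\<^esub> u, w'))"
        by (simp add: frag_extend_diff frag_extend_add)
      then show ?thesis
        unfolding tensor_relations_def using r a U.m_closed by blast
    next
      case b
      then have "left_ext a r = frag_of (env_right_mult L (a \<otimes>\<^bsub>env L\<^esub> u) x, w) -
          frag_of (a \<otimes>\<^bsub>env L\<^esub> u, env_act W x w)"
        using a by (simp add: frag_extend_diff env_right_mult_def U.m_assoc env_incl_closed)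
      then show ?thesis
        unfolding tensor_relations_def using b a U.m_closed by blast
    qed
  qed
  have "subgroup ?J FG"
  proof (rule FG.subgroupI)
    have "0 \<in> ?J"
      using subgroup.one_closed[OF kernel_subgroup] by simp
    then show "?J \<noteq> {}" by blast
  next
    fix q assume "q \<in> ?J"
    then show "inv\<^bsub>FG\<^esub> q \<in> ?J"
      using subgroup.m_inv_closed[OF kernel_subgroup, of "left_ext a q"] left_ext_closed[OF a, of q]
      by (simp add: frag_extend_minus)
  next
    fix p q assume "p \<in> ?J" "q \<in> ?J"
    then show "p \<otimes>\<^bsub>FG\<^esub> q \<in> ?J"
      using subgroup.m_closed[OF kernel_subgroup, of "left_ext a p" "left_ext a q"]
        FG_add_closed[of p q]
      by (simp add: frag_extend_add)
  qed auto
  moreover have "rels \<subseteq> ?J"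
    using rels rels_closed rels_kernel by blast
  ultimately have "generate FG rels \<subseteq> ?J"
    by (rule FG.generate_subgroup_incl[rotated])
  then show ?thesis
    using assms(2) unfolding kernel_generate by blast
qed

abbreviation left_mult where "left_mult \<equiv> induced_left_mult L H W"

lemma left_mult_coset:
  assumes "a \<in> carrier (env L)" "q \<in> carrier FG"
  shows "left_mult a (coset q) = coset (left_ext a q)"
  unfolding induced_left_mult_def
proof (rule the_elem_image_unique)
  show "coset q \<noteq> {}"
    using coset_self[OF assms(2)] by blast
  show "coset (left_ext a p) = coset (left_ext a q)" if "p \<in> coset q" for p
    using that assms left_ext_kernel[OF assms(1), of "p - q"]
    by (intro coset_eqI) (auto simp: mem_coset_iff left_ext_closed frag_extend_diff
        simp del: carrier_free_Abelian_group_iff)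
qed

lemma tens_closed: "\<lbrakk>u \<in> carrier (env L); w \<in> carrier W\<rbrakk> \<Longrightarrow> tens u w \<in> carrier Ind"
  by (simp add: carrier_Ind tens_def)

lemma tens_add_left:
  assumes "u \<in> carrier (env L)" "u' \<in> carrier (env L)" "w \<in> carrier W"
  shows "tens (u \<oplus>\<^bsub>env L\<^esub> u') w = tens u w \<oplus>\<^bsub>Ind\<^esub> tens u' w"
proof -
  have "frag_of (u \<oplus>\<^bsub>env L\<^esub> u', w) - (frag_of (u, w) + frag_of (u', w)) \<in> rels"
    unfolding tensor_relations_def using assms by blast
  then have "tens (u \<oplus>\<^bsub>env L\<^esub> u') w = coset (frag_of (u, w) + frag_of (u', w))"
    unfolding tens_def using assms
    by (intro coset_eqI rels_kernel FG_frag_of_closed FG_add_closed U.a_closed)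
  then show ?thesis
    unfolding tens_def using assms by (simp add: add_Ind FG_frag_of_closed del: carrier_free_Abelian_group_iff)
qed

lemma tens_balanced:
  assumes "u \<in> carrier (env L)" "r \<in> carrier (env (L\<lparr>carrier := H\<rparr>))" "w \<in> carrier W"
  shows "tens (u \<otimes>\<^bsub>env L\<^esub> env_incl L r) w = tens u (env_act W r w)"
proof -
  have "frag_of (env_right_mult L u r, w) - frag_of (u, env_act W r w) \<in> rels"
    unfolding tensor_relations_def using assms by blast
  then have "tens (env_right_mult L u r) w = tens u (env_act W r w)"
    unfolding tens_def using assms
    by (intro coset_eqI rels_kernel FG_frag_of_closed env_right_mult_closed W.env_act_closed)
  then show ?thesis
    by (simp only: env_right_mult_def)
qed

lemma left_mult_tens:
  "\<lbrakk>a \<in> carrier (env L); u \<in> carrier (env L); w \<in> carrier W\<rbrakk> \<Longrightarrow>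
    left_mult a (tens u w) = tens (a \<otimes>\<^bsub>env L\<^esub> u) w"
  by (simp add: tens_def left_mult_coset FG_frag_of_closed del: carrier_free_Abelian_group_iff)

lemma left_mult_closed: "\<lbrakk>a \<in> carrier (env L); v \<in> carrier Ind\<rbrakk> \<Longrightarrow> left_mult a v \<in> carrier Ind"
  by (auto simp: carrier_Ind left_mult_coset left_ext_closed simp del: carrier_free_Abelian_group_iff)

lemma left_mult_add_right:
  "\<lbrakk>a \<in> carrier (env L); v \<in> carrier Ind; v' \<in> carrier Ind\<rbrakk> \<Longrightarrow>
    left_mult a (v \<oplus>\<^bsub>Ind\<^esub> v') = left_mult a v \<oplus>\<^bsub>Ind\<^esub> left_mult a v'"
  by (auto simp: carrier_Ind left_mult_coset left_ext_closed add_Ind FG_add_closed frag_extend_add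
      simp del: carrier_free_Abelian_group_iff)

text \<open>Differences suffice, without scalar multiples, because the elements are integer
  combinations of pure tensors.\<close>

lemma Ind_induct [consumes 1, case_names tens diff]:
  assumes v: "v \<in> carrier Ind"
    and tens: "\<And>u w. \<lbrakk>u \<in> carrier (env L); w \<in> carrier W\<rbrakk> \<Longrightarrow> P (tens u w)"
    and diff: "\<And>v v'. \<lbrakk>v \<in> carrier Ind; v' \<in> carrier Ind; P v; P v'\<rbrakk> \<Longrightarrow> P (v \<ominus>\<^bsub>Ind\<^esub> v')"
  shows "P v"
proof -
  obtain q where q: "q \<in> carrier FG" "v = coset q"
    using v by (auto simp: carrier_Ind)
  have cl: "coset p \<in> carrier Ind" if "p \<in> carrier FG" for p
    using that by (simp add: carrier_Ind del: carrier_free_Abelian_group_iff)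
  have minus: "coset (p - p') = coset p \<ominus>\<^bsub>Ind\<^esub> coset p'"
    if "p \<in> carrier FG" "p' \<in> carrier FG" for p p'
  proof -
    have "coset (p - p') \<oplus>\<^bsub>Ind\<^esub> coset p' = coset p"
      using that by (simp add: add_Ind FG_diff_closed del: carrier_free_Abelian_group_iff)
    then have "coset p \<ominus>\<^bsub>Ind\<^esub> coset p' = coset (p - p') \<oplus>\<^bsub>Ind\<^esub> coset p' \<ominus>\<^bsub>Ind\<^esub> coset p'"
      by simp
    also have "\<dots> = coset (p - p')"
      using cl[OF FG_diff_closed[OF that]] cl[OF that(2)]
      by (simp add: Ind.minus_eq Ind.a_assoc Ind.r_neg)
    finally show ?thesis by simp
  qed
  \<comment> \<open>The zero coset is obtained as the difference of a pure tensor with itself; 1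
    \<otimes> 0 is one that is always available.\<close>
  have t: "P (tens \<one>\<^bsub>env L\<^esub> \<zero>\<^bsub>W\<^esub>)" and tc: "tens \<one>\<^bsub>env L\<^esub> \<zero>\<^bsub>W\<^esub> \<in> carrier Ind"
    using tens W.V.M.zero_closed U.one_closed tens_closed by blast+
  have "P (tens \<one>\<^bsub>env L\<^esub> \<zero>\<^bsub>W\<^esub> \<ominus>\<^bsub>Ind\<^esub> tens \<one>\<^bsub>env L\<^esub> \<zero>\<^bsub>W\<^esub>)"
    by (rule diff[OF tc tc t t])
  then have "P (coset 0)"
    using minus[of "frag_of (\<one>\<^bsub>env L\<^esub>, \<zero>\<^bsub>W\<^esub>)" "frag_of (\<one>\<^bsub>env L\<^esub>, \<zero>\<^bsub>W\<^esub>)"]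
    by (simp add: tens_def)
  have "Poly_Mapping.keys q \<subseteq> carrier (env L) \<times> carrier W"
    using q by simp
  then have "P (coset q)"
  proof (rule free_Abelian_group_induct[where P = "\<lambda>q. P (coset q)"])
    show "P (coset 0)" by fact
  next
    fix x y assume "Poly_Mapping.keys x \<subseteq> carrier (env L) \<times> carrier W"
      "Poly_Mapping.keys y \<subseteq> carrier (env L) \<times> carrier W" "P (coset x)" "P (coset y)"
    then show "P (coset (x - y))"
      using diff[OF cl cl, of x y] minus[of x y] by simp
  next
    fix a assume "a \<in> carrier (env L) \<times> carrier W"
    then show "P (coset (frag_of a))"
      using tens[of "fst a" "snd a"] by (auto simp: tens_def)
  qed
  then show ?thesis
    using q by simp
qed

text \<open>Serves for identities whose two sides are additive in \<open>v\<close>: they reduce to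
  pure tensors, where left multiplication is a product in the enveloping algebra.\<close>

lemma Ind_hom_eqI:
  assumes B: "abelian_group B"
    and f: "\<And>v. v \<in> carrier Ind \<Longrightarrow> f v \<in> carrier B"
    and fa: "\<And>v v'. \<lbrakk>v \<in> carrier Ind; v' \<in> carrier Ind\<rbrakk> \<Longrightarrow> f (v \<oplus>\<^bsub>Ind\<^esub> v') = f v \<oplus>\<^bsub>B\<^esub> f v'"
    and g: "\<And>v. v \<in> carrier Ind \<Longrightarrow> g v \<in> carrier B"
    and ga: "\<And>v v'. \<lbrakk>v \<in> carrier Ind; v' \<in> carrier Ind\<rbrakk> \<Longrightarrow> g (v \<oplus>\<^bsub>Ind\<^esub> v') = g v \<oplus>\<^bsub>B\<^esub> g v'"
    and eq: "\<And>u w. \<lbrakk>u \<in> carrier (env L); w \<in> carrier W\<rbrakk> \<Longrightarrow> f (tens u w) = g (tens u w)"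
    and v: "v \<in> carrier Ind"
  shows "f v = g v"
  using v
proof (induction v rule: Ind_induct)
  case (tens u w)
  then show ?case by (rule eq)
next
  case (diff v v')
  then show ?case
    using additive_minus[OF abelian_group_Ind B f fa diff(1,2)]
      additive_minus[OF abelian_group_Ind B g ga diff(1,2)]
    by simp
qed

lemma left_mult_add_left:
  assumes "a \<in> carrier (env L)" "b \<in> carrier (env L)" "v \<in> carrier Ind"
  shows "left_mult (a \<oplus>\<^bsub>env L\<^esub> b) v = left_mult a v \<oplus>\<^bsub>Ind\<^esub> left_mult b v"
  using assms(3)
  by (rule Ind_hom_eqI[OF abelian_group_Ind, rotated -1])
    (use assms in \<open>simp_all add: left_mult_add_right left_mult_closed left_mult_tens U.l_distr
       tens_add_left Ind.a_ac\<close>)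

lemma left_mult_mult:
  assumes "a \<in> carrier (env L)" "b \<in> carrier (env L)" "v \<in> carrier Ind"
  shows "left_mult (a \<otimes>\<^bsub>env L\<^esub> b) v = left_mult a (left_mult b v)"
  using assms(3)
  by (rule Ind_hom_eqI[OF abelian_group_Ind, rotated -1])
    (use assms in \<open>simp_all add: left_mult_add_right left_mult_closed left_mult_tens U.m_assoc\<close>)

lemma left_mult_one:
  assumes "v \<in> carrier Ind"
  shows "left_mult \<one>\<^bsub>env L\<^esub> v = v"
  using assms
  by (rule Ind_hom_eqI[OF abelian_group_Ind, rotated -1])
    (simp_all add: left_mult_add_right left_mult_closed left_mult_tens)

section \<open>The Lie module structure and its generators 1 \<otimes> w\<close>

lemma smult_Ind: "c \<odot>\<^bsub>Ind\<^esub> v = left_mult (env_class L (free_const c)) v"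
  by (simp add: induced_module_def)

lemma act_Ind: "act Ind x v = left_mult (env_class L (free_gen x)) v"
  by (simp add: induced_module_def)

lemma const_closed: "env_class L (free_const c) \<in> carrier (env L)"
  by (rule L.env_class_closed[OF L.free_const_closed])

lemma gen_closed: "x \<in> carrier L \<Longrightarrow> env_class L (free_gen x) \<in> carrier (env L)"
  by (rule L.env_class_closed[OF L.free_gen_closed])

text \<open>Scalars and elements of \<open>L\<close> both act by left multiplication with classes,
  so each axiom is the image of an identity in the enveloping algebra: the commutator relation for
  the bracket, centrality of constants for linearity.\<close>

lemma lie_module_Ind: "lie_module L Ind"
proof -
  have const_add: "env_class L (free_const (c + d)) =
      env_class L (free_const c) \<oplus>\<^bsub>env L\<^esub> env_class L (free_const d)" for c d
    by (simp add: single_add L.env_class_add L.free_const_closed)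
  have const_mult: "env_class L (free_const (c * d)) =
      env_class L (free_const c) \<otimes>\<^bsub>env L\<^esub> env_class L (free_const d)" for c d
    by (simp add: mult_single L.free_const_closed flip: L.env_class_mult)
  have "Module.module complex_ring Ind"
    by (rule moduleI[OF cring_complex_ring abelian_group_Ind])
      (simp_all add: smult_Ind left_mult_closed const_closed const_add const_mult left_mult_add_left
        left_mult_add_right left_mult_mult L.env_class_one left_mult_one)
  moreover have "act Ind (bracket L x y) v = act Ind x (act Ind y v) \<ominus>\<^bsub>Ind\<^esub> act Ind y (act Ind x v)"
    if "x \<in> carrier L" "y \<in> carrier L" "v \<in> carrier Ind" for x y v
  proof -
    have "act Ind (bracket L x y) v \<oplus>\<^bsub>Ind\<^esub> act Ind y (act Ind x v) = act Ind x (act Ind y v)"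
      unfolding act_Ind using that
      by (simp add: gen_closed L.bracket_closed L.env_class_gen_bracket
          flip: left_mult_mult left_mult_add_left)
    moreover have "act Ind (bracket L x y) v \<in> carrier Ind" "act Ind y (act Ind x v) \<in> carrier Ind"
      unfolding act_Ind using that by (simp_all add: left_mult_closed gen_closed L.bracket_closed)
    ultimately show ?thesis
      by (metis Ind.a_assoc Ind.a_inv_closed Ind.minus_eq Ind.r_neg Ind.r_zero)
  qed
  moreover have "act Ind x (c \<odot>\<^bsub>Ind\<^esub> v) = c \<odot>\<^bsub>Ind\<^esub> act Ind x v"
    if "x \<in> carrier L" "v \<in> carrier Ind" for x c v
    unfolding act_Ind smult_Ind using that
    by (simp add: gen_closed const_closed L.env_class_const_commute L.free_gen_closed flip: left_mult_mult)
  ultimately show ?thesis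
    by (intro lie_module.intro lie_module_axioms.intro L.lie_algebra_axioms)
      (simp_all add: act_Ind smult_Ind left_mult_closed gen_closed const_closed L.env_class_gen_add
        L.env_class_gen_smult left_mult_add_left left_mult_add_right left_mult_mult)
qed

sublocale Ind: lie_module L Ind by (rule lie_module_Ind)

lemma act_tens:
  "\<lbrakk>x \<in> carrier L; u \<in> carrier (env L); w \<in> carrier W\<rbrakk> \<Longrightarrow>
    act Ind x (tens u w) = tens (env_class L (free_gen x) \<otimes>\<^bsub>env L\<^esub> u) w"
  by (simp add: act_Ind left_mult_tens gen_closed)

lemma smult_tens:
  "\<lbrakk>u \<in> carrier (env L); w \<in> carrier W\<rbrakk> \<Longrightarrow>
    c \<odot>\<^bsub>Ind\<^esub> tens u w = tens (env_class L (free_const c) \<otimes>\<^bsub>env L\<^esub> u) w"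
  by (simp add: smult_Ind left_mult_tens const_closed)

text \<open>The balancing relation moves \<open>x\<close> across the tensor sign: x (1 \<otimes> w)
  = (1 x) \<otimes> w = 1 \<otimes> x w.\<close>

lemma act_one_tens:
  assumes "x \<in> H" "w \<in> carrier W"
  shows "act Ind x (tens \<one>\<^bsub>env L\<^esub> w) = tens \<one>\<^bsub>env L\<^esub> (act W x w)"
proof -
  have x: "free_gen x \<in> carrier W.L.FA"
    by (rule W.L.free_gen_closed) (simp add: assms)
  have cl: "env_class L (free_gen x) \<in> carrier (env L)"
    using assms subalgebra gen_closed by blast
  have "tens (\<one>\<^bsub>env L\<^esub> \<otimes>\<^bsub>env L\<^esub> env_incl L (env_class (L\<lparr>carrier := H\<rparr>) (free_gen x))) w =
      tens \<one>\<^bsub>env L\<^esub> (act W x w)"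
    using assms by (subst tens_balanced) (simp_all add: W.L.env_class_closed[OF x] W.env_act_gen)
  then show ?thesis
    using assms x cl subalgebra by (auto simp: env_incl_class act_tens)
qed

text \<open>The scalars on the left come from the enveloping algebra of \<open>L\<close>, those on
  the right from \<open>W\<close>. They agree because constants already lie in the enveloping
  algebra of \<open>H\<close> and can be moved across the tensor sign.\<close>

lemma smult_one_tens:
  assumes "w \<in> carrier W"
  shows "c \<odot>\<^bsub>Ind\<^esub> tens \<one>\<^bsub>env L\<^esub> w = tens \<one>\<^bsub>env L\<^esub> (c \<odot>\<^bsub>W\<^esub> w)"
proof -
  have x: "free_const c \<in> carrier W.L.FA"
    by (rule L.free_const_closed)
  have "tens (\<one>\<^bsub>env L\<^esub> \<otimes>\<^bsub>env L\<^esub> env_incl L (env_class (L\<lparr>carrier := H\<rparr>) (free_const c))) w =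
      tens \<one>\<^bsub>env L\<^esub> (c \<odot>\<^bsub>W\<^esub> w)"
    using assms by (subst tens_balanced) (simp_all add: W.L.env_class_closed[OF x] W.env_act_const)
  then show ?thesis
    using assms x by (simp add: env_incl_class smult_tens const_closed)
qed

text \<open>u \<otimes> w is u applied to 1 \<otimes> w, and u is a sum of scaled words: the
  coefficient is applied to 1 \<otimes> w, then the letters one by one from the right.\<close>

lemma Ind_generated:
  assumes one: "\<And>w. w \<in> carrier W \<Longrightarrow> tens \<one>\<^bsub>env L\<^esub> w \<in> S"
    and S: "S \<subseteq> carrier Ind"
    and add: "\<And>v v'. \<lbrakk>v \<in> S; v' \<in> S\<rbrakk> \<Longrightarrow> v \<oplus>\<^bsub>Ind\<^esub> v' \<in> S"
    and smult: "\<And>c v. v \<in> S \<Longrightarrow> c \<odot>\<^bsub>Ind\<^esub> v \<in> S"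
    and act: "\<And>x v. \<lbrakk>x \<in> carrier L; v \<in> S\<rbrakk> \<Longrightarrow> act Ind x v \<in> S"
    and v: "v \<in> carrier Ind"
  shows "v \<in> S"
  using v
proof (induction v rule: Ind_induct)
  case (tens u w)
  have word: "tens (env_class L (Poly_Mapping.single (Word xs) c)) w \<in> S"
    if "set xs \<subseteq> carrier L" for xs c
    using that
  proof (induction xs)
    case Nil
    have "c \<odot>\<^bsub>Ind\<^esub> tens \<one>\<^bsub>env L\<^esub> w \<in> S"
      by (intro smult one tens)
    then show ?case
      using tens const_closed by (simp add: smult_tens flip: zero_word_def)
  next
    case (Cons x xs)
    have cl: "Poly_Mapping.single (Word xs) c \<in> carrier L.FA" "free_gen x \<in> carrier L.FA"
      using Cons.prems by (simp_all add: single_in_free_algebra)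
    have "Poly_Mapping.single (Word (x # xs)) c = free_gen x * Poly_Mapping.single (Word xs) c"
      by (simp add: mult_single plus_word_def)
    then have "env_class L (Poly_Mapping.single (Word (x # xs)) c) =
        env_class L (free_gen x) \<otimes>\<^bsub>env L\<^esub> env_class L (Poly_Mapping.single (Word xs) c)"
      using cl by (simp add: L.env_class_mult)
    moreover have "act Ind x (tens (env_class L (Poly_Mapping.single (Word xs) c)) w) \<in> S"
      using Cons by (intro act) simp_all
    ultimately show ?case
      using Cons.prems tens cl by (simp add: act_tens L.env_class_closed)
  qed
  have "tens (env_class L p) w \<in> S" if "p \<in> carrier L.FA" for p
    using that
  proof (induction p rule: free_algebra_induct)
    case (single u c)
    then show ?case
      using word[of "letters u" c] by simp
  next
    case (add p q)
    then show ?case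
      using assms(3) tens by (simp add: L.env_class_add tens_add_left L.env_class_closed)
  qed
  then show ?case
    using tens by (auto simp: L.carrier_env)
next
  case (diff v v')
  have "v \<ominus>\<^bsub>Ind\<^esub> v' = v \<oplus>\<^bsub>Ind\<^esub> (- 1) \<odot>\<^bsub>Ind\<^esub> v'"
    using diff Ind.V.smult_l_minus[of 1 v'] Ind.V.smult_one[of v'] by (simp add: Ind.minus_eq)
  then show ?case
    using diff add smult by simp
qed

text \<open>Frobenius reciprocity: the extension of \<open>h\<close> sends \<open>u \<otimes> w\<close> to \<open>u \<cdot> h w\<close>.\<close>

lemma Ind_universal:
  assumes "lie_module L V"
    and h: "\<And>w. w \<in> carrier W \<Longrightarrow> h w \<in> carrier V"
    and h_add: "\<And>w w'. \<lbrakk>w \<in> carrier W; w' \<in> carrier W\<rbrakk> \<Longrightarrow> h (w \<oplus>\<^bsub>W\<^esub> w') = h w \<oplus>\<^bsub>V\<^esub> h w'"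
    and h_smult: "\<And>c w. w \<in> carrier W \<Longrightarrow> h (c \<odot>\<^bsub>W\<^esub> w) = c \<odot>\<^bsub>V\<^esub> h w"
    and h_act: "\<And>x w. \<lbrakk>x \<in> H; w \<in> carrier W\<rbrakk> \<Longrightarrow> h (act W x w) = act V x (h w)"
  obtains g where "\<And>v. v \<in> carrier Ind \<Longrightarrow> g v \<in> carrier V"
    "\<And>v v'. \<lbrakk>v \<in> carrier Ind; v' \<in> carrier Ind\<rbrakk> \<Longrightarrow> g (v \<oplus>\<^bsub>Ind\<^esub> v') = g v \<oplus>\<^bsub>V\<^esub> g v'"
    "\<And>c v. v \<in> carrier Ind \<Longrightarrow> g (c \<odot>\<^bsub>Ind\<^esub> v) = c \<odot>\<^bsub>V\<^esub> g v"
    "\<And>x v. \<lbrakk>x \<in> carrier L; v \<in> carrier Ind\<rbrakk> \<Longrightarrow> g (act Ind x v) = act V x (g v)"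
    "\<And>w. w \<in> carrier W \<Longrightarrow> g (tens \<one>\<^bsub>env L\<^esub> w) = h w"
proof -
  interpret V: lie_module L V by fact
  let ?f = "\<lambda>(u, w). env_act V u (h w)"
  have h_word: "h (foldr (act W) xs w) = foldr (act V) xs (h w) \<and> foldr (act W) xs w \<in> carrier W"
    if "set xs \<subseteq> H" "w \<in> carrier W" for xs w
    using that W.act_closed by (induction xs) (auto simp: h_act)
  \<comment> \<open>A linear \<open>H\<close>-equivariant map respects the action of the whole
    enveloping algebra of \<open>H\<close>, as one sees on words; \<open>env_incl\<close> reads the
    same representative inside that of \<open>L\<close>.\<close>
  have h_env: "h (env_act W r w) = env_act V (env_incl L r) (h w)"
    if "r \<in> carrier (env (L\<lparr>carrier := H\<rparr>))" "w \<in> carrier W" for r w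
  proof -
    have "h (free_act W p w) = free_act V p (h w)" if "p \<in> carrier (free_algebra H)" for p
      using that
    proof (induction p rule: free_algebra_induct)
      case (single u c)
      then have "set (letters u) \<subseteq> carrier L"
        using subalgebra by blast
      then show ?case
        using single \<open>w \<in> carrier W\<close>
        by (simp add: W.free_act_single V.free_act_single h h_word h_smult)
    next
      case (add p q)
      moreover have "p \<in> carrier L.FA" "q \<in> carrier L.FA"
        using add free_algebra_mono[OF subalgebra] by auto
      ultimately show ?case
        using \<open>w \<in> carrier W\<close> W.free_act_closed
        by (simp add: W.free_act_add_left V.free_act_add_left h h_add)
    qed
    moreover obtain p where "p \<in> carrier (free_algebra H)" "r = env_class (L\<lparr>carrier := H\<rparr>) p"
      using \<open>r \<in> _\<close> by (auto simp: W.L.carrier_env)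
    ultimately show ?thesis
      using \<open>w \<in> carrier W\<close> h free_algebra_mono[OF subalgebra]
      by (simp add: W.env_act_class V.env_act_class env_incl_class)
  qed
  have "?f ` (carrier (env L) \<times> carrier W) \<subseteq> carrier (add_monoid V)"
    using V.env_act_closed h by auto
  \<comment> \<open>An additive map on the free abelian group, before any relation is imposed;
    descending to the quotient amounts to killing \<open>rels\<close>.\<close>
  then obtain k where k: "k \<in> hom FG (add_monoid V)"
      "\<And>x. x \<in> carrier (env L) \<times> carrier W \<Longrightarrow> k (frag_of x) = ?f x"
    by (rule comm_group.free_Abelian_group_universal[OF V.V.M.a_comm_group]) (rule that)
  interpret k: group_hom FG "add_monoid V" k
    using k(1) by (simp add: group_hom_def group_hom_axioms_def V.V.M.a_group)
  have k_frag: "k (frag_of (u, w)) = env_act V u (h w)"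
    if "u \<in> carrier (env L)" "w \<in> carrier W" for u w
    using k(2)[of "(u, w)"] that by simp
  have k_add: "k (p + q) = k p \<oplus>\<^bsub>V\<^esub> k q" if "p \<in> carrier FG" "q \<in> carrier FG" for p q
    using k.hom_mult[OF that] by simp
  have k_diff: "k (p - q) = \<zero>\<^bsub>V\<^esub>" if "p \<in> carrier FG" "q \<in> carrier FG" "k p = k q" for p q
  proof -
    have "k q = k (p - q) \<oplus>\<^bsub>V\<^esub> k q"
      using k_add[OF FG_diff_closed[OF that(1,2)] that(2)] that(3) by simp
    moreover have "k (p - q) \<in> carrier V" "k q \<in> carrier V"
      using k.hom_closed[OF FG_diff_closed[OF that(1,2)]] k.hom_closed[OF that(2)] by simp_all
    ultimately show ?thesis
      using V.V.M.add.r_cancel_one' by blast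
  qed
  have "rels \<subseteq> kernel FG (add_monoid V) k"
  proof
    fix r assume r: "r \<in> rels"
    note cl = FG_frag_of_closed FG_add_closed W.V.M.a_closed W.env_act_closed env_right_mult_closed
    have "k r = \<zero>\<^bsub>V\<^esub>"
      using r unfolding tensor_relations_def
    proof (elim UnE CollectE exE conjE)
      fix u u' w
      assume "r = frag_of (u \<oplus>\<^bsub>env L\<^esub> u', w) - (frag_of (u, w) + frag_of (u', w))"
        "u \<in> carrier (env L)" "u' \<in> carrier (env L)" "w \<in> carrier W"
      then show ?thesis
        by (simp add: k_diff cl k_add k_frag V.env_act_add_left h del: carrier_free_Abelian_group_iff)
    next
      fix u w w'
      assume "r = frag_of (u, w \<oplus>\<^bsub>W\<^esub> w') - (frag_of (u, w) + frag_of (u, w'))"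
        "u \<in> carrier (env L)" "w \<in> carrier W" "w' \<in> carrier W"
      then show ?thesis
        by (simp add: k_diff cl k_add k_frag V.env_act_add_right h h_add del: carrier_free_Abelian_group_iff)
    next
      fix u x w
      assume *: "r = frag_of (env_right_mult L u x, w) - frag_of (u, env_act W x w)"
        "u \<in> carrier (env L)" "x \<in> carrier (env (L\<lparr>carrier := H\<rparr>))" "w \<in> carrier W"
      \<comment> \<open>The balancing relation is where equivariance of \<open>h\<close> enters,
        through \<open>h_env\<close>.\<close>
      have "env_act V (env_right_mult L u x) (h w) = env_act V u (h (env_act W x w))"
        using * by (simp add: env_right_mult_def V.env_act_mult env_incl_closed h h_env)
      then show ?thesis
        using * by (simp add: k_diff cl k_frag del: carrier_free_Abelian_group_iff)
    qed
    then show "r \<in> kernel FG (add_monoid V) k"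
      using subsetD[OF rels_closed r] by (simp add: kernel_def)
  qed
  then have "induced_kernel L H W \<subseteq> kernel FG (add_monoid V) k"
    unfolding kernel_generate by (rule FG.generate_subgroup_incl[OF _ k.subgroup_kernel])
  then obtain g where g: "g \<in> hom (FG Mod induced_kernel L H W) (add_monoid V)"
      "\<And>q. q \<in> carrier FG \<Longrightarrow> g (coset q) = k q"
    using k.FactGroup_universal_kernel[OF kernel_normal] by metis
  have g_closed: "g v \<in> carrier V" if "v \<in> carrier Ind" for v
    using that k.hom_closed by (auto simp: carrier_Ind g(2) simp del: carrier_free_Abelian_group_iff)
  have g_add: "g (v \<oplus>\<^bsub>Ind\<^esub> v') = g v \<oplus>\<^bsub>V\<^esub> g v'" if "v \<in> carrier Ind" "v' \<in> carrier Ind" for v v'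
    using that
    by (auto simp: carrier_Ind g(2) add_Ind k_add FG_add_closed simp del: carrier_free_Abelian_group_iff)
  have g_tens: "g (tens u w) = env_act V u (h w)" if "u \<in> carrier (env L)" "w \<in> carrier W" for u w
    using that by (simp add: tens_def g(2) k_frag)
  \<comment> \<open>On pure tensors both sides are the product a u applied to h w. Compatibility
    with scalars and with \<open>L\<close> are the cases of a constant and of a generator.\<close>
  have g_left: "g (left_mult a v) = env_act V a (g v)"
    if "a \<in> carrier (env L)" "v \<in> carrier Ind" for a v
    using that(2)
    by (rule Ind_hom_eqI[OF V.V.M.abelian_group_axioms, rotated -1])
      (use that(1) in \<open>simp_all add: left_mult_closed g_closed g_add left_mult_add_right
        V.env_act_closed V.env_act_add_right left_mult_tens g_tens V.env_act_mult h\<close>)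
  show thesis
  proof (rule that[of g])
    fix c v assume "v \<in> carrier Ind"
    then show "g (c \<odot>\<^bsub>Ind\<^esub> v) = c \<odot>\<^bsub>V\<^esub> g v"
      by (simp add: smult_Ind g_left const_closed V.env_act_const g_closed)
  next
    fix x v assume "x \<in> carrier L" "v \<in> carrier Ind"
    then show "g (act Ind x v) = act V x (g v)"
      by (simp add: act_Ind g_left gen_closed V.env_act_gen g_closed)
  next
    fix w assume "w \<in> carrier W"
    then show "g (tens \<one>\<^bsub>env L\<^esub> w) = h w"
      by (simp add: g_tens V.env_act_one h)
  qed (use g_closed g_add in auto)
qed

end

section \<open>The Virasoro algebra\<close>

locale complex_space = vector_space scale
  for scale :: "complex \<Rightarrow> 'b \<Rightarrow> 'b :: ab_group_add" (infixr \<open>*s\<close> 75)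
begin

text \<open>The common shape of the bracket of \<open>Vir\<close> and of the action on \<Omega>,
  both sums over the support of an element, with values in \<open>vir\<close> and in polynomials
  respectively.\<close>

definition lin_ext :: "('k \<Rightarrow> 'b) \<Rightarrow> ('k \<Rightarrow>\<^sub>0 complex) \<Rightarrow> 'b" where
  "lin_ext F x = (\<Sum>a\<in>Poly_Mapping.keys x. Poly_Mapping.lookup x a *s F a)"

lemma lin_ext_superset:
  "\<lbrakk>finite S; Poly_Mapping.keys x \<subseteq> S\<rbrakk> \<Longrightarrow> lin_ext F x = (\<Sum>a\<in>S. Poly_Mapping.lookup x a *s F a)"
  unfolding lin_ext_def by (rule sum.mono_neutral_left) (auto simp: in_keys_iff)

lemma lin_ext_add: "lin_ext F (x + y) = lin_ext F x + lin_ext F y"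
proof -
  let ?S = "Poly_Mapping.keys x \<union> Poly_Mapping.keys y"
  have "lin_ext F (x + y) = (\<Sum>a\<in>?S. Poly_Mapping.lookup (x + y) a *s F a)"
    using keys_add[of x y] by (intro lin_ext_superset) auto
  also have "\<dots> = lin_ext F x + lin_ext F y"
    by (simp add: lin_ext_superset[of ?S x] lin_ext_superset[of ?S y] lookup_add scale_left_distrib
        sum.distrib)
  finally show ?thesis .
qed

text \<open>The assumption is pointwise because the locale fixes a scaling on the target only, not
  on the finitely supported functions.\<close>

lemma lin_ext_scaled:
  assumes "\<And>a. Poly_Mapping.lookup y a = c * Poly_Mapping.lookup x a"
  shows "lin_ext F y = c *s lin_ext F x"
proof -
  have "lin_ext F y = (\<Sum>a\<in>Poly_Mapping.keys x. Poly_Mapping.lookup y a *s F a)"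
    using assms by (intro lin_ext_superset) (auto simp: in_keys_iff)
  then show ?thesis
    by (simp add: lin_ext_def assms scale_sum_right)
qed

lemma lin_ext_single: "lin_ext F (Poly_Mapping.single a c) = c *s F a"
  by (simp add: lin_ext_superset[of "{a}"])

lemma lin_ext_fun_add: "lin_ext (\<lambda>a. F a + G a) x = lin_ext F x + lin_ext G x"
  by (simp add: lin_ext_def scale_right_distrib sum.distrib)

lemma lin_ext_fun_scale: "lin_ext (\<lambda>a. c *s F a) x = c *s lin_ext F x"
  by (simp add: lin_ext_def scale_sum_right mult.commute)

end

interpretation vir: complex_space vir_scale ..

interpretation poly_smult: complex_space Polynomial.smult
  by standard (simp_all add: smult_add_right smult_add_left)

text \<open>Bridge from type-class vector spaces to module records, for the structures whose carrier
  is a whole type.\<close>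

lemma module_complex_ringI:
  fixes s :: "complex \<Rightarrow> 'v \<Rightarrow> 'v :: ab_group_add"
  assumes "vector_space s" "carrier V = UNIV" "ring.add V = (+)" "\<zero>\<^bsub>V\<^esub> = 0" "module.smult V = s"
  shows "Module.module complex_ring V"
proof -
  interpret vector_space s by fact
  have "abelian_group V"
  proof (rule abelian_groupI)
    show "\<exists>y\<in>carrier V. y \<oplus>\<^bsub>V\<^esub> x = \<zero>\<^bsub>V\<^esub>" for x
      using assms by (intro bexI[of _ "- x"]) simp_all
  qed (simp_all add: assms ac_simps)
  then show ?thesis
    by (intro moduleI cring_complex_ring)
      (simp_all add: assms scale_left_distrib scale_right_distrib)
qed

lemma vector_space_complex_mult: "vector_space ((*) :: complex \<Rightarrow> complex \<Rightarrow> complex)"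
  by standard (simp_all add: algebra_simps)

lemma abelian_group_minus_eq:
  fixes x y :: "'v :: ab_group_add"
  assumes "abelian_group V" "carrier V = UNIV" "ring.add V = (+)" "\<zero>\<^bsub>V\<^esub> = 0"
  shows "x \<ominus>\<^bsub>V\<^esub> y = x - y"
proof -
  interpret abelian_group V by fact
  have "\<ominus>\<^bsub>V\<^esub> y = - y"
    by (rule minus_equality) (simp_all add: assms)
  then show ?thesis
    by (simp add: minus_eq assms)
qed

lemma vir_induct [case_names add scale z e]:
  assumes add: "\<And>x y. P x \<Longrightarrow> P y \<Longrightarrow> P (x + y)"
    and scale: "\<And>c x. P x \<Longrightarrow> P (vir_scale c x)"
    and z: "P vir_z" and e: "\<And>k. P (vir_e k)"
  shows "P x"
proof -
  have single: "P (Poly_Mapping.single a c)" for a c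
  proof -
    have "Poly_Mapping.single a c = vir_scale c (Poly_Mapping.single a 1)"
      by (intro poly_mapping_eqI) (simp add: lookup_vir_scale lookup_single when_def)
    moreover have "P (Poly_Mapping.single a 1)"
      using z e by (cases a) (simp_all add: vir_z_def vir_e_def)
    ultimately show ?thesis
      using scale by simp
  qed
  have "P (\<Sum>a\<in>A. Poly_Mapping.single a (Poly_Mapping.lookup x a))" if "finite A" for A
    using that
  proof (induction A)
    case empty
    then show ?case using single[of Basis_z 0] by simp
  next
    case (insert a A)
    then show ?case by (simp add: add single)
  qed
  from this[OF finite_keys[of x]] show ?thesis
    by (simp only: poly_mapping_eq_sum_single)
qed

section \<open>Bilinearity, antisymmetry and the Jacobi identity for the bracket\<close>

lemma vir_bracket_lin_ext:
  "vir_bracket x y = vir.lin_ext (\<lambda>a. vir.lin_ext (basis_bracket a) y) x"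
  by (simp add: vir_bracket_def vir.lin_ext_def vir.scale_sum_right)

lemma vir_bracket_add_left: "vir_bracket (x + y) w = vir_bracket x w + vir_bracket y w"
  by (simp add: vir_bracket_lin_ext vir.lin_ext_add)

lemma vir_bracket_scale_left: "vir_bracket (vir_scale c x) w = vir_scale c (vir_bracket x w)"
  unfolding vir_bracket_lin_ext by (rule vir.lin_ext_scaled) (simp add: lookup_vir_scale)

lemma vir_bracket_add_right: "vir_bracket w (x + y) = vir_bracket w x + vir_bracket w y"
  by (simp add: vir_bracket_lin_ext vir.lin_ext_add vir.lin_ext_fun_add)

lemma vir_bracket_scale_right: "vir_bracket w (vir_scale c x) = vir_scale c (vir_bracket w x)"
proof -
  have "vir.lin_ext (basis_bracket a) (vir_scale c x) = vir_scale c (vir.lin_ext (basis_bracket a) x)" for a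
    by (rule vir.lin_ext_scaled) (simp add: lookup_vir_scale)
  then show ?thesis
    by (simp add: vir_bracket_lin_ext vir.lin_ext_fun_scale)
qed

lemma vir_bracket_zero [simp]: "vir_bracket 0 x = 0" "vir_bracket x 0 = 0"
  by (simp_all add: vir_bracket_def)

lemma vir_bracket_e_e:
  "vir_bracket (vir_e j) (vir_e k) = vir_scale (of_int (k - j)) (vir_e (j + k))
     + (if k = - j then vir_scale ((of_int j ^ 3 - of_int j) / 12) vir_z else 0)"
  unfolding vir_bracket_lin_ext vir_e_def[of j] vir_e_def[of k] vir.lin_ext_single by simp

lemma vir_bracket_z [simp]: "vir_bracket vir_z x = 0" "vir_bracket x vir_z = 0"
proof -
  show "vir_bracket vir_z x = 0"
    by (simp add: vir_bracket_lin_ext vir_z_def vir.lin_ext_single vir.lin_ext_def)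
  have "basis_bracket a Basis_z = 0" for a
    by (cases a) simp_all
  then show "vir_bracket x vir_z = 0"
    by (simp add: vir_bracket_lin_ext vir_z_def vir.lin_ext_single vir.lin_ext_def)
qed

lemmas vir_bracket_bilinear = vir_bracket_add_left vir_bracket_add_right vir_bracket_scale_left
  vir_bracket_scale_right

lemma vir_bracket_swap: "vir_bracket x y = - vir_bracket y x"
proof (induction x rule: vir_induct)
  case (e j)
  show ?case
  proof (induction y rule: vir_induct)
    case (e k)
    have "vir_scale (of_int (k - j)) (vir_e (j + k)) = - vir_scale (of_int (j - k)) (vir_e (k + j))"
      by (simp add: add.commute flip: vir.scale_minus_left)
    \<comment> \<open>Antisymmetry of the central term is oddness of the cubic
      \<open>j ^ 3 - j\<close>.\<close>
    moreover have "vir_scale ((of_int j ^ 3 - of_int j) / 12) vir_z =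
        - vir_scale ((of_int k ^ 3 - of_int k) / 12) vir_z" if "k = - j"
      by (simp add: that minus_divide_left flip: vir.scale_minus_left)
    ultimately show ?case
      by (simp add: vir_bracket_e_e)
  qed (simp_all add: vir_bracket_bilinear)
qed (simp_all add: vir_bracket_bilinear)

lemma vir_bracket_self: "vir_bracket x x = 0"
proof -
  have "vir_scale 2 (vir_bracket x x) = vir_bracket x x + vir_bracket x x"
    using vir.scale_left_distrib[of 1 1 "vir_bracket x x"] by simp
  also have "\<dots> = 0"
    using vir_bracket_swap[of x x] by (simp add: eq_neg_iff_add_eq_0)
  finally show ?thesis by simp
qed

text \<open>The three cyclic summands have the same index sum and so involve the same two vectors.
  The identity splits into a polynomial identity for the coefficient of
  \<open>vir_e (j + k + m)\<close> and the cocycle identity for that of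
  \<open>vir_z\<close>.\<close>

lemma vir_jacobi_e:
  "vir_bracket (vir_e j) (vir_bracket (vir_e k) (vir_e m)) + vir_bracket (vir_e k) (vir_bracket (vir_e m) (vir_e j))
    + vir_bracket (vir_e m) (vir_bracket (vir_e j) (vir_e k)) = 0"
proof -
  define c :: "int \<Rightarrow> complex" where "c i = (of_int i ^ 3 - of_int i) / 12" for i
  \<comment> \<open>\<open>D 0\<close> is \<open>vir_z\<close> exactly when the three indices add up
    to 0, the only case in which an outer bracket has a central term.\<close>
  define D where "D i = (if i = j + k + m then vir_z else 0)" for i
  have br: "vir_bracket (vir_e p) (vir_bracket (vir_e q) (vir_e r)) =
      vir_scale (of_int ((r - q) * (q + r - p))) (vir_e (j + k + m))
      + vir_scale (of_int (r - q) * c p) (D 0)"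
    if "p + q + r = j + k + m" for p q r
  proof -
    have "vir_bracket (vir_e q) (vir_e r) = vir_scale (of_int (r - q)) (vir_e (q + r)) +
        (if r = - q then vir_scale (c q) vir_z else 0)"
      by (simp add: vir_bracket_e_e c_def)
    \<comment> \<open>The central term of the inner bracket is killed by the outer one.\<close>
    then have "vir_bracket (vir_e p) (vir_bracket (vir_e q) (vir_e r)) =
        vir_scale (of_int (r - q)) (vir_bracket (vir_e p) (vir_e (q + r)))"
      by (simp add: vir_bracket_bilinear)
    moreover have "q + r = - p \<longleftrightarrow> 0 = j + k + m"
      using that by linarith
    moreover have "p + (q + r) = j + k + m"
      using that by linarith
    ultimately show ?thesis
      unfolding vir_bracket_e_e c_def D_def by (simp add: vir.scale_right_distrib)
  qed
  \<comment> \<open>The cocycle identity of the Virasoro extension; substituting m = - j - k turns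
    it into a polynomial identity in j and k.\<close>
  have z: "of_int (m - k) * c j + of_int (j - m) * c k + of_int (k - j) * c m = 0" if "0 = j + k + m"
  proof -
    have "m = - j - k"
      using that by linarith
    then have m: "of_int m = (- of_int j - of_int k :: complex)"
      by simp
    show ?thesis
      unfolding c_def of_int_diff m by (simp add: field_simps power3_eq_cube)
  qed
  let ?E = "vir_e (j + k + m)"
  have "vir_bracket (vir_e j) (vir_bracket (vir_e k) (vir_e m)) + vir_bracket (vir_e k) (vir_bracket (vir_e m) (vir_e j))
    + vir_bracket (vir_e m) (vir_bracket (vir_e j) (vir_e k)) =
    vir_scale (of_int ((m - k) * (k + m - j) + (j - m) * (m + j - k) + (k - j) * (j + k - m))) ?E
    + vir_scale (of_int (m - k) * c j + of_int (j - m) * c k + of_int (k - j) * c m) (D 0)"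
    using br[of j k m] br[of k m j] br[of m j k] by (simp add: vir.scale_left_distrib)
  moreover have "(m - k) * (k + m - j) + (j - m) * (m + j - k) + (k - j) * (j + k - m) = 0"
    by (simp add: algebra_simps)
  moreover have "vir_scale (of_int (m - k) * c j + of_int (j - m) * c k + of_int (k - j) * c m) (D 0) = 0"
    using z by (simp add: D_def)
  ultimately show ?thesis
    by (simp only: of_int_0 vir.scale_zero_left add_0)
qed

text \<open>The expression is trilinear and vanishes when one argument is central, so basis vectors
  can be replaced by arbitrary elements one argument at a time.\<close>

lemma vir_jacobi:
  "vir_bracket x (vir_bracket y w) + vir_bracket y (vir_bracket w x) + vir_bracket w (vir_bracket x y) = 0"
proof -
  define J where "J x y w = vir_bracket x (vir_bracket y w) + vir_bracket y (vir_bracket w x)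
    + vir_bracket w (vir_bracket x y)" for x y w
  have add: "J (x + x') y w = J x y w + J x' y w" "J x (y + y') w = J x y w + J x y' w"
    "J x y (w + w') = J x y w + J x y w'" for x x' y y' w w'
    by (simp_all add: J_def vir_bracket_bilinear)
  have scale: "J (vir_scale c x) y w = vir_scale c (J x y w)" "J x (vir_scale c y) w = vir_scale c (J x y w)"
    "J x y (vir_scale c w) = vir_scale c (J x y w)" for c x y w
    by (simp_all add: J_def vir_bracket_bilinear vir.scale_right_distrib)
  have z: "J vir_z y w = 0" "J x vir_z w = 0" "J x y vir_z = 0" for x y w
    by (simp_all add: J_def)
  have e: "J (vir_e j) (vir_e k) (vir_e m) = 0" for j k m
    unfolding J_def by (rule vir_jacobi_e)
  have "J (vir_e j) (vir_e k) w = 0" for j k w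
    by (induction w rule: vir_induct) (simp_all add: add scale z e)
  then have "J (vir_e j) y w = 0" for j y w
    by (induction y rule: vir_induct) (simp_all add: add scale z)
  then have "J x y w = 0"
    by (induction x rule: vir_induct) (simp_all add: add scale z)
  then show ?thesis
    by (simp add: J_def)
qed

lemma Vir_simps [simp]:
  "carrier Vir = UNIV" "x \<oplus>\<^bsub>Vir\<^esub> y = x + y" "\<zero>\<^bsub>Vir\<^esub> = 0" "c \<odot>\<^bsub>Vir\<^esub> x = vir_scale c x"
  "bracket Vir x y = vir_bracket x y"
  by (simp_all add: Vir_def)

lemma lie_algebra_Vir: "lie_algebra Vir"
proof -
  have "Module.module complex_ring Vir"
    by (rule module_complex_ringI[OF vir.vector_space_axioms]) (simp_all add: Vir_def)
  then show ?thesis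
    by (intro lie_algebra.intro lie_algebra_axioms.intro)
      (simp_all add: vir_bracket_bilinear vir_bracket_self vir_jacobi)
qed

section \<open>The module \<open>\<Omega>\<close>\<close>

definition omega_basis :: "complex \<Rightarrow> complex \<Rightarrow> complex poly \<Rightarrow> vir_basis \<Rightarrow> complex poly" where
  "omega_basis l b f a = (\<Sum>n\<le>degree f. Polynomial.smult (poly.coeff f n) (omega_basis_act l b a n))"

lemma omega_basis_z [simp]: "omega_basis l b f Basis_z = 0"
  by (simp add: omega_basis_def)

lemma pcompose_eq_sum:
  fixes f q :: "'a :: comm_semiring_1 poly"
  shows "pcompose f q = (\<Sum>n\<le>degree f. Polynomial.smult (poly.coeff f n) (q ^ n))"
  by (simp add: pcompose_altdef poly_altdef coeff_map_poly degree_map_poly)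

text \<open>The powers of \<partial> - k weighted by the coefficients of \<open>f\<close> add up to
  the composition of \<open>f\<close> with \<partial> - k. After this closed form, computations no
  longer refer to single coefficients.\<close>

lemma omega_basis_e:
  "omega_basis l b f (Basis_e k) =
    Polynomial.smult (l powi k) ([:of_int k * (b - 1), 1:] * pcompose f [:- of_int k, 1:])"
  unfolding omega_basis_def pcompose_eq_sum[of f]
  by (simp add: sum_distrib_left poly_smult.scale_sum_right mult.commute del: mult_pCons_left)

lemma omega_act_lin_ext: "omega_act l b x f = poly_smult.lin_ext (omega_basis l b f) x"
  by (simp add: omega_act_def omega_basis_def poly_smult.lin_ext_def poly_smult.scale_sum_right)

lemma omega_act_add_left: "omega_act l b (x + y) f = omega_act l b x f + omega_act l b y f"
  by (simp add: omega_act_lin_ext poly_smult.lin_ext_add)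

lemma omega_act_scale_left:
  "omega_act l b (vir_scale c x) f = Polynomial.smult c (omega_act l b x f)"
  unfolding omega_act_lin_ext by (rule poly_smult.lin_ext_scaled) (simp add: lookup_vir_scale)

lemma omega_act_z [simp]: "omega_act l b vir_z f = 0"
  by (simp add: omega_act_lin_ext vir_z_def poly_smult.lin_ext_single)

lemma omega_act_zero [simp]: "omega_act l b 0 f = 0" "omega_act l b x 0 = 0"
  by (simp_all add: omega_act_def)

lemma omega_act_e:
  "omega_act l b (vir_e k) f =
    Polynomial.smult (l powi k) ([:of_int k * (b - 1), 1:] * pcompose f [:- of_int k, 1:])"
  by (simp add: omega_act_lin_ext vir_e_def poly_smult.lin_ext_single omega_basis_e)

lemma omega_act_add_right: "omega_act l b x (f + g) = omega_act l b x f + omega_act l b x g"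
  by (induction x rule: vir_induct)
    (simp_all add: omega_act_add_left omega_act_scale_left omega_act_e pcompose_add distrib_left
      smult_add_right del: mult_pCons_left)

lemma omega_act_scale_right:
  "omega_act l b x (Polynomial.smult c f) = Polynomial.smult c (omega_act l b x f)"
  by (induction x rule: vir_induct)
    (simp_all add: omega_act_add_left omega_act_scale_left omega_act_e pcompose_smult
      smult_add_right mult.commute del: mult_pCons_left)

lemmas omega_act_bilinear = omega_act_add_left omega_act_add_right omega_act_scale_left
  omega_act_scale_right

text \<open>Substituting \<partial> - j is a ring homomorphism: it shifts the linear factor left
  behind by e_k, and combines with the earlier substitution to a shift by j + k.\<close>

lemma omega_act_e_e:
  assumes "l \<noteq> 0"
  shows "omega_act l b (vir_e j) (omega_act l b (vir_e k) f) =
    Polynomial.smult (l powi (j + k)) ([:of_int j * (b - 1), 1:] * [:of_int k * (b - 1) - of_int j, 1:]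
      * pcompose f [:- of_int (j + k), 1:])"
proof -
  have "pcompose (pcompose f [:- of_int k, 1:]) [:- of_int j, 1:] = pcompose f [:- of_int (j + k), 1:]"
  proof -
    have "pcompose [:- of_int k, 1:] [:- of_int j, 1:] = [:- of_int (j + k), 1 :: complex:]"
      by (simp add: pcompose_pCons)
    then show ?thesis
      by (simp only: flip: pcompose_assoc)
  qed
  moreover have "pcompose [:of_int k * (b - 1), 1:] [:- of_int j, 1:] = [:of_int k * (b - 1) - of_int j, 1:]"
    by (simp add: pcompose_pCons)
  ultimately show ?thesis
    using assms
    by (simp add: omega_act_e pcompose_smult pcompose_mult power_int_add mult.assoc
        del: mult_pCons_left of_int_add)
qed

text \<open>Both orders of composition carry the same power of \<open>l\<close> and the same shift
  of \<open>f\<close>. What remains is an identity of quadratics, P j k - P k j = (k - j)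
  (\<partial> + (j + k) (b - 1)); the central term acts by 0.\<close>

lemma omega_act_bracket_e:
  assumes "l \<noteq> 0"
  shows "omega_act l b (vir_bracket (vir_e j) (vir_e k)) f =
    omega_act l b (vir_e j) (omega_act l b (vir_e k) f) - omega_act l b (vir_e k) (omega_act l b (vir_e j) f)"
proof -
  let ?h = "pcompose f [:- of_int (j + k), 1:]"
  define P where "P i n = [:of_int i * (b - 1), 1:] * [:of_int n * (b - 1) - of_int i, 1:]" for i n
  have e: "omega_act l b (vir_e i) (omega_act l b (vir_e n) f) = Polynomial.smult (l powi (j + k)) (P i n * ?h)"
    if "i + n = j + k" for i n
    by (simp only: omega_act_e_e[OF assms] P_def that)
  have "omega_act l b (vir_bracket (vir_e j) (vir_e k)) f =
      Polynomial.smult (l powi (j + k)) (Polynomial.smult (of_int (k - j)) [:of_int (j + k) * (b - 1), 1:] * ?h)"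
    by (simp add: vir_bracket_e_e omega_act_bilinear omega_act_e
        mult_smult_left mult.commute[of "of_int (k - j)"] del: mult_pCons_left smult_pCons of_int_add of_int_diff)
  also have "Polynomial.smult (of_int (k - j)) [:of_int (j + k) * (b - 1), 1:] = P j k - P k j"
    by (simp add: P_def algebra_simps)
  finally show ?thesis
    by (simp only: e[of j k] e[of k j] add.commute left_diff_distrib smult_diff_right)
qed

lemma omega_act_bracket:
  assumes "l \<noteq> 0"
  shows "omega_act l b (vir_bracket x y) f =
    omega_act l b x (omega_act l b y f) - omega_act l b y (omega_act l b x f)"
proof (induction x rule: vir_induct)
  case (e j)
  show ?case
    by (induction y rule: vir_induct)
      (simp_all add: vir_bracket_bilinear omega_act_bilinear omega_act_bracket_e[OF assms] smult_diff_right)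
qed (simp_all add: vir_bracket_bilinear omega_act_bilinear smult_diff_right)

lemma Omega_simps [simp]:
  "carrier (Omega l b) = UNIV" "f \<oplus>\<^bsub>Omega l b\<^esub> g = f + g" "\<zero>\<^bsub>Omega l b\<^esub> = 0"
  "c \<odot>\<^bsub>Omega l b\<^esub> f = Polynomial.smult c f" "act (Omega l b) x f = omega_act l b x f"
  by (simp_all add: Omega_def)

lemma lie_module_Omega:
  assumes "l \<noteq> 0"
  shows "lie_module Vir (Omega l b)"
proof -
  have M: "Module.module complex_ring (Omega l b)"
    by (rule module_complex_ringI[OF poly_smult.vector_space_axioms]) (simp_all add: Omega_def)
  then have "f \<ominus>\<^bsub>Omega l b\<^esub> g = f - g" for f g
    by (intro abelian_group_minus_eq) (simp_all add: Module.module_def Omega_def)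
  with M show ?thesis
    by (intro lie_module.intro lie_module_axioms.intro lie_algebra_Vir)
      (simp_all add: omega_act_bilinear omega_act_bracket[OF assms])
qed

section \<open>The subalgebra and its character\<close>

lemma vir_z_in_sub: "vir_z \<in> vir_sub l"
  by (simp add: vir_sub_def vir.span_base)

lemma vir_gen_in_sub: "vir_e (k + 1) - vir_scale l (vir_e k) \<in> vir_sub l"
  by (simp add: vir_sub_def vir.span_base)

lemma vir_sub_closed:
  "0 \<in> vir_sub l" "x \<in> vir_sub l \<Longrightarrow> y \<in> vir_sub l \<Longrightarrow> x + y \<in> vir_sub l"
  "x \<in> vir_sub l \<Longrightarrow> vir_scale c x \<in> vir_sub l"
  by (simp_all add: vir_sub_def vir.span_zero vir.span_add vir.span_scale)

text \<open>Membership of the accumulated sum is carried along because an abstract character is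
  linear only on the subalgebra.\<close>

lemma vir_sub_induct [consumes 1, case_names zero z gen]:
  assumes "x \<in> vir_sub l" "P 0"
    and "\<And>c y. y \<in> vir_sub l \<Longrightarrow> P y \<Longrightarrow> P (vir_scale c vir_z + y)"
    and "\<And>c k y. y \<in> vir_sub l \<Longrightarrow> P y \<Longrightarrow> P (vir_scale c (vir_e (k + 1) - vir_scale l (vir_e k)) + y)"
  shows "P x"
proof -
  have "x \<in> vir_sub l \<and> P x"
    using assms(1) unfolding vir_sub_def
  proof (induction x rule: vir.span_induct_alt)
    case base
    then show ?case using assms(2) vir.span_zero by blast
  next
    case (step c x y)
    then have y: "y \<in> vir_sub l" "P y"
      by (simp_all add: vir_sub_def)
    from step(1) have "x = vir_z \<or> (\<exists>k. x = vir_e (k + 1) - vir_scale l (vir_e k))"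
      by auto
    then have "P (vir_scale c x + y)" "x \<in> vir_sub l"
      using assms(3,4) y vir_z_in_sub vir_gen_in_sub by auto
    then show ?case
      using y vir_sub_closed(2)[of "vir_scale c x" l y] vir_sub_closed(3)[of x l c]
      by (simp add: vir_sub_def)
  qed
  then show ?thesis ..
qed

text \<open>Modulo the subalgebra, e_(k+1) is \<open>l\<close> times e_k, so every e_k is congruent
  to a multiple of e_0: multiply by \<open>l\<close> going up, divide by it going down.\<close>

lemma vir_sub_decomp:
  assumes "l \<noteq> 0"
  obtains h c where "h \<in> vir_sub l" "x = h + vir_scale c (vir_e 0)"
proof -
  let ?D = "\<lambda>x. \<exists>h c. h \<in> vir_sub l \<and> x = h + vir_scale c (vir_e 0)"
  have add: "?D (x + y)" if xy: "?D x" "?D y" for x y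
  proof -
    obtain h c h' c' where "h \<in> vir_sub l" "x = h + vir_scale c (vir_e 0)"
      "h' \<in> vir_sub l" "y = h' + vir_scale c' (vir_e 0)"
      using xy by blast
    then have "h + h' \<in> vir_sub l" "x + y = (h + h') + vir_scale (c + c') (vir_e 0)"
      by (simp_all add: vir_sub_closed vir.scale_left_distrib)
    then show ?thesis by blast
  qed
  have scale: "?D (vir_scale d x)" if x: "?D x" for d x
  proof -
    obtain h c where "h \<in> vir_sub l" "x = h + vir_scale c (vir_e 0)"
      using x by blast
    then have "vir_scale d h \<in> vir_sub l" "vir_scale d x = vir_scale d h + vir_scale (d * c) (vir_e 0)"
      by (simp_all add: vir_sub_closed vir.scale_right_distrib)
    then show ?thesis by blast
  qed
  have sub: "?D h" if "h \<in> vir_sub l" for h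
    using that by (intro exI[of _ h] exI[of _ 0]) simp
  have e: "?D (vir_e k)" for k
  proof (induction k rule: int_induct[of _ 0])
    case base
    show ?case
      by (intro exI[of _ 0] exI[of _ 1]) (simp add: vir_sub_closed)
  next
    case (step1 k)
    have "?D ((vir_e (k + 1) - vir_scale l (vir_e k)) + vir_scale l (vir_e k))"
      by (intro add sub vir_gen_in_sub scale step1)
    then show ?case by simp
  next
    case (step2 k)
    \<comment> \<open>The coefficients come from solving the generator e_k - l e_(k-1) for
      e_(k-1).\<close>
    have "?D (vir_scale (- 1 / l) (vir_e (k - 1 + 1) - vir_scale l (vir_e (k - 1))) + vir_scale (1 / l) (vir_e k))"
      by (intro add sub vir_gen_in_sub scale step2)
    moreover have "vir_scale (- 1 / l) (vir_e (k - 1 + 1) - vir_scale l (vir_e (k - 1))) + vir_scale (1 / l) (vir_e k)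
        = vir_e (k - 1)"
      using assms by (simp add: vir.scale_right_diff_distrib)
    ultimately show ?case
      by (simp only:)
  qed
  have "?D x"
  proof (induction x rule: vir_induct)
    case z
    show ?case by (rule sub[OF vir_z_in_sub])
  qed (fact add scale e)+
  then show thesis
    using that by blast
qed

text \<open>Taking a coefficient makes this linear on all of \<open>Vir\<close>; it serves as a
  character on the subalgebra, where the image of 1 is constant.\<close>

definition omega_char :: "complex \<Rightarrow> complex \<Rightarrow> vir \<Rightarrow> complex" where
  "omega_char l b x = poly.coeff (omega_act l b x 1) 0"

text \<open>Origin of the values of \<open>\<mu>\<close>: the terms in \<partial> cancel, and the
  constants (k + 1) (b - 1) and k (b - 1) differ by b - 1.\<close>

lemma omega_act_gen_one:
  assumes "l \<noteq> 0"
  shows "omega_act l b (vir_e (k + 1) - vir_scale l (vir_e k)) 1 = [:l powi (k + 1) * (b - 1):]"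
proof -
  have "omega_act l b (vir_e (k + 1) - vir_scale l (vir_e k)) 1 =
      omega_act l b (vir_e (k + 1)) 1 + Polynomial.smult (- l) (omega_act l b (vir_e k) 1)"
    by (simp flip: omega_act_bilinear)
  then show ?thesis
    using assms by (simp add: omega_act_e pcompose_1 power_int_add algebra_simps)
qed

lemma omega_act_sub_one:
  assumes "l \<noteq> 0" "x \<in> vir_sub l"
  shows "omega_act l b x 1 = [:omega_char l b x:]"
proof -
  have "degree (omega_act l b x 1) = 0"
    using assms(2)
  proof (induction x rule: vir_sub_induct)
    case zero
    show ?case by simp
  next
    case (z c y)
    then show ?case by (simp add: omega_act_bilinear)
  next
    case (gen c k y)
    then show ?case
      using degree_add_le[of "[:c * (l powi (k + 1) * (b - 1)):]" 0 "omega_act l b y 1"]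
      by (simp add: omega_act_bilinear omega_act_gen_one[OF assms(1)])
  qed
  then show ?thesis
    unfolding omega_char_def by (metis coeff_pCons_0 degree_0_id)
qed

text \<open>Since e_0 sends 1 to \<partial>, the coefficient of e_0 in the decomposition of
  \<open>x\<close> is the linear coefficient of the image of 1, and it vanishes if that image is
  constant.\<close>

lemma vir_subI:
  assumes "l \<noteq> 0" "omega_act l b x 1 = [:a:]"
  shows "x \<in> vir_sub l"
proof -
  obtain h c where h: "h \<in> vir_sub l" "x = h + vir_scale c (vir_e 0)"
    using vir_sub_decomp[OF assms(1)] by blast
  then have "omega_act l b x 1 = [:omega_char l b h, c:]"
    by (simp add: omega_act_bilinear omega_act_sub_one[OF assms(1)] omega_act_e pcompose_1)
  then have "c = 0"
    using assms(2) by simp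
  then show ?thesis
    using h by simp
qed

lemma omega_char_linear:
  "omega_char l b (x + y) = omega_char l b x + omega_char l b y"
  "omega_char l b (vir_scale c x) = c * omega_char l b x"
  by (simp_all add: omega_char_def omega_act_bilinear)

text \<open>Both elements act on constants by scalars, and scalars commute. From this follow closure
  of the subalgebra under the bracket, by \<open>vir_subI\<close>, and the vanishing of
  \<open>omega_char\<close> on brackets.\<close>

lemma omega_act_bracket_sub_one:
  assumes "l \<noteq> 0" "x \<in> vir_sub l" "y \<in> vir_sub l"
  shows "omega_act l b (vir_bracket x y) 1 = [:0:]"
proof -
  have "omega_act l b x [:c:] = Polynomial.smult c (omega_act l b x 1)" for x c
    using omega_act_scale_right[of l b x c 1] by simp
  then show ?thesis
    by (simp add: omega_act_bracket[OF assms(1)] omega_act_sub_one[OF assms(1,2)]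
        omega_act_sub_one[OF assms(1,3)] mult.commute)
qed

lemma vir_bracket_in_sub:
  "\<lbrakk>l \<noteq> 0; x \<in> vir_sub l; y \<in> vir_sub l\<rbrakk> \<Longrightarrow> vir_bracket x y \<in> vir_sub l"
  \<comment> \<open>The subalgebra does not involve \<open>b\<close>, so one value suffices; 0 is an
    arbitrary choice.\<close>
  using vir_subI[OF _ omega_act_bracket_sub_one[where b = 0]] by blast

lemma lie_algebra_Vir_sub:
  assumes "l \<noteq> 0"
  shows "lie_algebra (Vir_sub l)"
proof -
  interpret Vir: lie_algebra Vir by (rule lie_algebra_Vir)
  have "abelian_group (Vir_sub l)"
  proof (rule abelian_groupI)
    fix x assume "x \<in> carrier (Vir_sub l)"
    then show "\<exists>y\<in>carrier (Vir_sub l). y \<oplus>\<^bsub>Vir_sub l\<^esub> x = \<zero>\<^bsub>Vir_sub l\<^esub>"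
      using vir_sub_closed(3)[of x l "- 1"] by (intro bexI[of _ "- x"]) simp_all
  qed (simp_all add: vir_sub_closed ac_simps)
  then have "Module.module complex_ring (Vir_sub l)"
    by (intro moduleI cring_complex_ring)
      (simp_all add: vir_sub_closed vir.scale_left_distrib vir.scale_right_distrib)
  then show ?thesis
    using assms
    by (intro lie_algebra.intro lie_algebra_axioms.intro)
      (simp_all add: vir_bracket_in_sub vir_bracket_bilinear vir_bracket_self vir_jacobi)
qed

lemma lie_algebra_abelian_complex: "lie_algebra abelian_complex"
proof -
  have "Module.module complex_ring abelian_complex"
    by (rule module_complex_ringI[OF vector_space_complex_mult]) (simp_all add: abelian_complex_def)
  then show ?thesis
    by (intro lie_algebra.intro lie_algebra_axioms.intro) (simp_all add: abelian_complex_def)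
qed

text \<open>The prescribed values are consistent because the action on 1 realises them. Restricting
  fixes the function outside the subalgebra, for the uniqueness statement.\<close>

lemma is_mu_omega_char:
  assumes "l \<noteq> 0"
  shows "is_mu l b (restrict (omega_char l b) (vir_sub l))"
proof -
  have "lie_hom (Vir_sub l) abelian_complex (restrict (omega_char l b) (vir_sub l))"
    using omega_act_bracket_sub_one[OF assms, of _ _ b] assms
    by (intro lie_hom.intro lie_hom_axioms.intro lie_algebra_Vir_sub lie_algebra_abelian_complex)
      (simp_all add: abelian_complex_def vir_sub_closed omega_char_linear vir_bracket_in_sub
        omega_char_def[of l b "vir_bracket _ _"])
  moreover have "omega_char l b (vir_e (k + 1) - vir_scale l (vir_e k)) = l powi (k + 1) * (b - 1)" for k
    by (simp add: omega_char_def omega_act_gen_one[OF assms])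
  moreover have "omega_char l b vir_z = 0"
    by (simp add: omega_char_def)
  ultimately show ?thesis
    by (simp add: is_mu_def vir_z_in_sub vir_gen_in_sub)
qed

text \<open>Linearity and the values on the spanning family determine \<open>\<mu>\<close>. Hence
  the subalgebra acts on constant polynomials through \<open>\<mu>\<close>, which makes
  \<open>\<lambda>c. [:c:]\<close> equivariant.\<close>

lemma is_mu_eq_omega_char:
  assumes "l \<noteq> 0" "is_mu l b \<mu>" "x \<in> vir_sub l"
  shows "\<mu> x = omega_char l b x"
proof -
  interpret lie_hom "Vir_sub l" abelian_complex \<mu>
    using assms(2) by (simp add: is_mu_def)
  have lin: "\<mu> (vir_scale c x + y) = c * \<mu> x + \<mu> y" if "x \<in> vir_sub l" "y \<in> vir_sub l" for c x y
    using hom_add[of "vir_scale c x" y] hom_smult[of x c] that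
    by (simp add: vir_sub_closed abelian_complex_def)
  have mu: "\<mu> vir_z = 0" "\<And>k. \<mu> (vir_e (k + 1) - vir_scale l (vir_e k)) = l powi (k + 1) * (b - 1)"
    using assms(2) by (simp_all add: is_mu_def)
  show ?thesis
    using assms(3)
  proof (induction x rule: vir_sub_induct)
    case zero
    show ?case
      using lin[of 0 0 1] vir_sub_closed(1) by (simp add: omega_char_def)
  next
    case (z c y)
    then show ?case
      by (simp add: lin vir_z_in_sub mu omega_char_linear omega_char_def[of l b vir_z])
  next
    case (gen c k y)
    then show ?case
      by (simp add: lin vir_gen_in_sub mu omega_char_linear omega_act_gen_one[OF assms(1)]
          omega_char_def[of l b "vir_e _ - _"])
  qed
qed

section \<open>The isomorphism\<close>

lemma char_module_simps [simp]:
  "carrier (char_module \<mu>) = UNIV" "c \<oplus>\<^bsub>char_module \<mu>\<^esub> d = c + d"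
  "c \<odot>\<^bsub>char_module \<mu>\<^esub> d = c * d" "act (char_module \<mu>) x c = \<mu> x * c"
  by (simp_all add: char_module_def)

lemma lie_module_char_module:
  assumes "lie_hom L abelian_complex \<mu>"
  shows "lie_module L (char_module \<mu>)"
proof -
  interpret lie_hom L abelian_complex \<mu> by fact
  have M: "Module.module complex_ring (char_module \<mu>)"
    by (rule module_complex_ringI[OF vector_space_complex_mult]) (simp_all add: char_module_def)
  then have "c \<ominus>\<^bsub>char_module \<mu>\<^esub> d = c - d" for c d
    by (intro abelian_group_minus_eq) (simp_all add: Module.module_def char_module_def)
  with M show ?thesis
    using hom_add hom_smult hom_bracket
    by (intro lie_module.intro lie_module_axioms.intro dom.lie_algebra_axioms)
      (simp_all add: abelian_complex_def distrib_left distrib_right mult.assoc mult.left_commute)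
qed

lemma omega_act_e_zero: "omega_act l b (vir_e 0) f = pCons 0 f"
  by (simp add: omega_act_e)

text \<open>Only the map \<open>g\<close> out of the induced module is equivariant by construction.
  Its inverse \<open>f\<close> is built as a linear map; surjectivity of \<open>f\<close> and
  \<open>g (f p) = p\<close> make both bijective.\<close>

lemma lie_module_isomorphic_Omega:
  assumes l: "l \<noteq> 0" and mu: "is_mu l b \<mu>"
  shows "lie_module_isomorphic Vir (Omega l b) (V_module l \<mu>)"
proof -
  interpret Vir: lie_algebra Vir by (rule lie_algebra_Vir)
  interpret W: lie_module "Vir_sub l" "char_module \<mu>"
    using mu by (intro lie_module_char_module) (simp add: is_mu_def)
  interpret S: subalgebra_module Vir "vir_sub l" "char_module \<mu>"
    by unfold_locales simp
  interpret Om: lie_module Vir "Omega l b" by (rule lie_module_Omega[OF l])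
  let ?V = "S.Ind" and ?e = "vir_e 0"
  define v0 where "v0 = S.tens \<one>\<^bsub>env Vir\<^esub> 1"
  have v0: "v0 \<in> carrier ?V"
    by (simp add: v0_def S.tens_closed)
  note cl = v0 S.Ind.act_closed[simplified] S.Ind.V.smult_closed[simplified] S.Ind.a_closed
    S.Ind.zero_closed
  have act_v0: "act ?V h v0 = \<mu> h \<odot>\<^bsub>?V\<^esub> v0" if "h \<in> vir_sub l" for h
    using that by (simp add: v0_def S.act_one_tens S.smult_one_tens)
  obtain g where g: "\<And>v. v \<in> carrier ?V \<Longrightarrow> g v \<in> carrier (Omega l b)"
    "\<And>v v'. \<lbrakk>v \<in> carrier ?V; v' \<in> carrier ?V\<rbrakk> \<Longrightarrow> g (v \<oplus>\<^bsub>?V\<^esub> v') = g v \<oplus>\<^bsub>Omega l b\<^esub> g v'"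
    "\<And>c v. v \<in> carrier ?V \<Longrightarrow> g (c \<odot>\<^bsub>?V\<^esub> v) = c \<odot>\<^bsub>Omega l b\<^esub> g v"
    "\<And>x v. \<lbrakk>x \<in> carrier Vir; v \<in> carrier ?V\<rbrakk> \<Longrightarrow> g (act ?V x v) = act (Omega l b) x (g v)"
    "\<And>c. c \<in> carrier (char_module \<mu>) \<Longrightarrow> g (S.tens \<one>\<^bsub>env Vir\<^esub> c) = [:c:]"
  proof (rule S.Ind_universal[OF lie_module_Omega[OF l, of b], of "\<lambda>c. [:c:]"])
    fix x c assume "x \<in> vir_sub l"
    then show "[:act (char_module \<mu>) x c:] = act (Omega l b) x [:c:]"
      using omega_act_scale_right[of l b x c 1]
      by (simp add: omega_act_sub_one[OF l] is_mu_eq_omega_char[OF l mu] mult.commute)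
  qed auto
  have g_v0: "g v0 = 1"
    using g(5)[of 1] by (simp add: v0_def one_pCons)
  \<comment> \<open>Horner's scheme for \<open>p \<mapsto> p(e\<^sub>0) v\<^sub>0\<close>\<close>
  define f where "f p = fold_coeffs (\<lambda>a v. a \<odot>\<^bsub>?V\<^esub> v0 \<oplus>\<^bsub>?V\<^esub> act ?V ?e v) p \<zero>\<^bsub>?V\<^esub>" for p
  have act_zero: "act ?V x \<zero>\<^bsub>?V\<^esub> = \<zero>\<^bsub>?V\<^esub>" for x
    using S.Ind.act_smult_right[of x "\<zero>\<^bsub>?V\<^esub>" 0] S.Ind.V.smult_l_null cl by simp
  have smult_0: "0 \<odot>\<^bsub>?V\<^esub> v = \<zero>\<^bsub>?V\<^esub>" if "v \<in> carrier ?V" for v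
    using S.Ind.V.smult_l_null[of v] that by simp
  have f_0: "f 0 = \<zero>\<^bsub>?V\<^esub>"
    by (simp add: f_def)
  \<comment> \<open>\<open>fold_coeffs\<close> skips leading zeros, so for \<open>a = 0\<close> and
    \<open>p = 0\<close> the equation holds because its right-hand side is the zero vector.\<close>
  have f_pCons: "f (pCons a p) = a \<odot>\<^bsub>?V\<^esub> v0 \<oplus>\<^bsub>?V\<^esub> act ?V ?e (f p)" for a p
    using v0 by (cases "p = 0 \<and> a = 0") (auto simp: f_def smult_0 act_zero)
  have f_closed: "f p \<in> carrier ?V" for p
    by (induction p) (simp_all add: f_0 f_pCons cl)
  have f_add: "f (p + q) = f p \<oplus>\<^bsub>?V\<^esub> f q" for p q
  proof (induction p q rule: poly_induct2)
    case 0
    then show ?case by (simp add: f_0)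
  next
    case (pCons a p b q)
    then show ?case
      using S.Ind.V.smult_l_distr[of a b v0]
      by (simp add: f_pCons S.Ind.act_add_right f_closed cl S.Ind.a_ac)
  qed
  have f_smult: "f (Polynomial.smult c p) = c \<odot>\<^bsub>?V\<^esub> f p" for c p
  proof (induction p)
    case 0
    then show ?case
      using S.Ind.V.smult_r_null[of c] by (simp add: f_0)
  next
    case (pCons a p)
    then show ?case
      using S.Ind.V.smult_assoc1[of c a v0]
      by (simp add: f_pCons S.Ind.V.smult_r_distr S.Ind.act_smult_right f_closed cl)
  qed
  have act_e: "act ?V ?e (f p) = f (pCons 0 p)" for p
    by (simp add: f_pCons smult_0 cl f_closed)
  \<comment> \<open>The element \<open>x\<close> must be arbitrary in the induction: for h = e_(k+1)
    - l e_k the bracket [h, e_0] is - (k + 1) h - l e_k, which is outside the subalgebra.\<close>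
  have act_f: "\<exists>q. act ?V x (f p) = f q" for x p
  proof (induction p arbitrary: x)
    case 0
    then show ?case
      using act_zero f_0 by metis
  next
    case (pCons a p)
    obtain h c where h: "h \<in> vir_sub l" "x = h + vir_scale c ?e"
      by (rule vir_sub_decomp[OF l])
    have v0f: "v0 = f 1"
      using S.Ind.V.smult_one[OF v0] by (simp add: one_pCons f_pCons f_0 act_zero cl)
    obtain q1 where q1: "act ?V h (f p) = f q1"
      using pCons.IH by blast
    obtain q2 where q2: "act ?V (vir_bracket h ?e) (f p) = f q2"
      using pCons.IH by blast
    \<comment> \<open>Commuting \<open>h\<close> past e_0 leaves only actions on \<open>f p\<close>,
      one Horner step earlier, where the induction hypothesis applies to \<open>h\<close> and to the
      bracket.\<close>
    have "act ?V h (act ?V ?e (f p)) = act ?V (vir_bracket h ?e) (f p) \<oplus>\<^bsub>?V\<^esub> act ?V ?e (act ?V h (f p))"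
      using S.Ind.act_bracket[of h ?e "f p"]
      by (simp add: cl f_closed S.Ind.minus_eq S.Ind.a_assoc S.Ind.l_neg)
    then have he: "act ?V h (f (pCons 0 p)) = f (q2 + pCons 0 q1)"
      by (simp only: q1 q2 act_e f_add)
    have "act ?V h (f (pCons a p)) = f (Polynomial.smult (a * \<mu> h) 1 + (q2 + pCons 0 q1))"
    proof -
      have "act ?V h (f (pCons a p)) = (a * \<mu> h) \<odot>\<^bsub>?V\<^esub> v0 \<oplus>\<^bsub>?V\<^esub> act ?V h (act ?V ?e (f p))"
        using S.Ind.V.smult_assoc1[of a "\<mu> h" v0]
        by (simp add: f_pCons S.Ind.act_add_right S.Ind.act_smult_right cl f_closed act_v0 h(1))
      then show ?thesis
        by (simp only: act_e he v0f f_add f_smult)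
    qed
    moreover have "act ?V x (f (pCons a p)) =
        act ?V h (f (pCons a p)) \<oplus>\<^bsub>?V\<^esub> c \<odot>\<^bsub>?V\<^esub> act ?V ?e (f (pCons a p))"
      using S.Ind.act_add_left[of h "vir_scale c ?e"] S.Ind.act_smult_left[of ?e _ c]
      by (simp add: h(2) f_closed)
    ultimately have "act ?V x (f (pCons a p)) =
        f (Polynomial.smult (a * \<mu> h) 1 + (q2 + pCons 0 q1) + Polynomial.smult c (pCons 0 (pCons a p)))"
      by (simp only: act_e f_add f_smult)
    then show ?case by blast
  qed
  have surj: "v \<in> range f" if v: "v \<in> carrier ?V" for v
    using v
  proof (rule S.Ind_generated[rotated -1])
    show "S.tens \<one>\<^bsub>env Vir\<^esub> c \<in> range f" for c
    proof -
      have "S.tens \<one>\<^bsub>env Vir\<^esub> c = c \<odot>\<^bsub>?V\<^esub> v0"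
        by (simp add: v0_def S.smult_one_tens)
      also have "\<dots> = f [:c:]"
        by (simp add: f_pCons f_0 act_zero cl)
      finally show ?thesis by simp
    qed
    show "range f \<subseteq> carrier ?V"
      using f_closed by blast
    show "v \<oplus>\<^bsub>?V\<^esub> v' \<in> range f" if "v \<in> range f" "v' \<in> range f" for v v'
      using that by (auto simp flip: f_add)
    show "c \<odot>\<^bsub>?V\<^esub> v \<in> range f" if "v \<in> range f" for c v
      using that by (auto simp flip: f_smult)
    show "act ?V x v \<in> range f" if "v \<in> range f" for x v
      using that act_f[of x] by (metis imageE rangeI)
  qed
  \<comment> \<open>Multiplication by \<partial> is the action of e_0 on \<Omega>, so
    \<open>g\<close> carries Horner's scheme in the induced module to Horner's scheme for
    \<open>p\<close> itself.\<close>
  have g_f: "g (f p) = p" for p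
  proof (induction p)
    case 0
    then show ?case
      using g(3)[OF v0, of 0] by (simp add: f_0 smult_0 v0)
  next
    case (pCons a p)
    then show ?case
      by (simp add: f_pCons g(2-4) cl f_closed g_v0 omega_act_e_zero)
  qed
  have f_g: "f (g v) = v" if "v \<in> carrier ?V" for v
    using surj[OF that] by (auto simp: g_f)
  have "bij_betw g (carrier ?V) (carrier (Omega l b))"
    by (intro bij_betwI[of _ _ _ f]) (simp_all add: f_g g_f f_closed)
  then have "lie_module_iso Vir ?V (Omega l b) g"
    using g(2-4)
    by (intro lie_module_iso.intro lie_module_iso_axioms.intro S.lie_module_Ind lie_module_Omega l) auto
  then have "lie_module_iso Vir (Omega l b) ?V (inv_into (carrier ?V) g)"
    by (rule lie_module_iso_inv)
  then show ?thesis
    unfolding lie_module_isomorphic_def V_module_def by blast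
qed

text \<open>A function on all of \<open>Vir\<close> is not determined by a character of a proper
  subalgebra, hence \<open>extensional\<close> in the uniqueness part. The isomorphism is stated for
  every function representing the character, whatever its values elsewhere.\<close>

theorem proposition4p8:
  fixes l b :: complex
  assumes "l \<noteq> 0"
  shows "(\<exists>!\<mu>. \<mu> \<in> extensional (vir_sub l) \<and> is_mu l b \<mu>)
    \<and> (\<forall>\<mu>. is_mu l b \<mu> \<longrightarrow> lie_module_isomorphic Vir (Omega l b) (V_module l \<mu>))"
proof (intro conjI allI impI)
  show "\<exists>!\<mu>. \<mu> \<in> extensional (vir_sub l) \<and> is_mu l b \<mu>"
  proof (rule ex1I)
    show "restrict (omega_char l b) (vir_sub l) \<in> extensional (vir_sub l)
        \<and> is_mu l b (restrict (omega_char l b) (vir_sub l))"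
      using is_mu_omega_char[OF assms] by simp
  next
    fix \<mu> assume "\<mu> \<in> extensional (vir_sub l) \<and> is_mu l b \<mu>"
    then show "\<mu> = restrict (omega_char l b) (vir_sub l)"
      by (intro extensionalityI[of _ "vir_sub l"]) (auto simp: is_mu_eq_omega_char[OF assms])
  qed
qed (rule lie_module_isomorphic_Omega[OF assms])

end
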